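(* Let $n,d\ge0$ be integers. For every formal power series $L(z,\bar z,u)\colon\mathbb C^n_z\to\mathbb C^n_{\bar z}\times\mathbb C^d_w$ without constant terms and every formal power series $f_0(z,u)\in\mathbb C^n$ and $g_0(u)\in\mathbb R^d$ without constant and linear terms, there exist unique formal power series $f(z,\bar z,u)\in\mathbb C^n$ and $g(z,\bar z,u)\in\mathbb R^d$ without constant and linear terms such that $f(z,0,u)=f_0(z,u)$ and $g(0,0,u)=g_0(u)$ and such that the map $\mathrm{id}+(f,g)$ transforms $L$ into $L'$ satisfying the normalization $$\tilde L'^{\bar z'}(z',\bar z',u')\equiv0,\qquad \operatorname{Re}\tilde L'^{w'}(z',\bar z',u')\equiv0.$$
   Context: Coordinates $(z,u)=(x+iy,u)\in\mathbb C^n\times\mathbb R^d$. The complexified tangent space at each point is identified with $\mathbb C^n_z\times\mathbb C^n_{\bar z}\times\mathbb C^d_w$ with complex coordinates $dz=dx+i\,dy$, $d\bar z=dx-i\,dy$, and $dw$ extending $du$. A formal power series $L(z,\bar z,u)=(L^{\bar z},L^w)$ in $(z,\bar z,u)$, with values complex-linear maps $\mathbb C^n_z\to\mathbb C^n_{\bar z}\times\mathbb C^d_w$ and $L(0)=0$, represents the formal almost CR structure (of CR dimension $n$ and CR codimension $d$) whose $(1,0)$ bundle $H^{1,0}$ is the graph $(d\bar z,dw)=L(z,\bar z,u)\,dz$. Formal power series in $(z,\bar z,u)$ are treated with $z,\bar z$ as independent variables, e.g. in $f(z,0,u)$; $\mathbb R^d$-valued means real under conjugation interchanging $z$ and $\bar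 z$. The map $\mathrm{id}+(f,g)$ is $z'=z+f(z,\bar z,u)$, $u'=u+g(z,\bar z,u)$. It transforms $L$ into the map $L'=(L'^{\bar z'},L'^{w'})$ representing the transformed almost CR structure in the coordinates $(z',u')$, i.e. $$g_z+g_{\bar z}L^{\bar z}+(\mathrm{id}+g_u)L^w=L'^{w'}(\mathrm{id}+f_z+f_{\bar z}L^{\bar z}+f_uL^w),$$ $$\bar f_z+(\mathrm{id}+\bar f_{\bar z})L^{\bar z}+\bar f_uL^w=L'^{\bar z'}(\mathrm{id}+f_z+f_{\bar z}L^{\bar z}+f_uL^w),$$ where $f,\bar f,g,L$ are taken at $(z,\bar z,u)$ and $L'$ at $(z,\bar z,u)+(f,\bar f,g)(z,\bar z,u)$. For such $L$, the evaluation along the Euler vector field $e(z)=\sum_jz_j\frac{\partial}{\partial z_j}$ is $\tilde L(z,\bar z,u):=L(z,\bar z,u)e(z)=(\tilde L^{\bar z},\tilde L^w)$, and similarly for $L'$. *)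

theory Defs
  imports
    Complex_Main
    "HOL-Library.Poly_Mapping"
    "Jordan_Normal_Form.Matrix"
begin

section \<open>Formal power series in several variables\<close>

text \<open>A series with variables indexed by \<open>'v\<close> is the family of its coefficients, indexed by the
  exponents of the monomials, i.e. by the finitely supported functions from \<open>'v\<close> to the naturals.\<close>

typedef ('v, 'a) mps = "UNIV :: (('v \<Rightarrow>\<^sub>0 nat) \<Rightarrow> 'a) set"
  morphisms mps_coeff Abs_mps
  by simp

lemma mps_coeff_Abs [simp]: "mps_coeff (Abs_mps c) = c"
  by (simp add: Abs_mps_inverse)

lemma mps_eqI: "(\<And>m. mps_coeff F m = mps_coeff G m) \<Longrightarrow> F = G"
  by (metis ext mps_coeff_inject)

lemma finite_add_decompositions: "finite {(a, b). a + b = (m :: 'v \<Rightarrow>\<^sub>0 nat)}"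
proof -
  let ?A = "{a. \<exists>b. a + b = m}"
  let ?R = "\<lambda>a. restrict (Poly_Mapping.lookup a) (Poly_Mapping.keys m)"
  have le: "Poly_Mapping.lookup a v \<le> Poly_Mapping.lookup m v" if "a \<in> ?A" for a v
    using that by (auto simp: lookup_add)
  have "?R ` ?A \<subseteq> (\<Pi>\<^sub>E v\<in>Poly_Mapping.keys m. {..Poly_Mapping.lookup m v})"
    using le by auto
  moreover have "finite (\<Pi>\<^sub>E v\<in>Poly_Mapping.keys m. {..Poly_Mapping.lookup m v})"
    by (intro finite_PiE) auto
  ultimately have "finite (?R ` ?A)"
    by (rule finite_subset)
  moreover have "inj_on ?R ?A"
  proof (rule inj_onI, rule poly_mapping_eqI)
    fix a b v
    assume a: "a \<in> ?A" and b: "b \<in> ?A" and eq: "?R a = ?R b"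
    show "Poly_Mapping.lookup a v = Poly_Mapping.lookup b v"
    proof (cases "v \<in> Poly_Mapping.keys m")
      case True
      then show ?thesis using fun_cong[OF eq, of v] by simp
    next
      case False
      then have "Poly_Mapping.lookup m v = 0" by (simp add: in_keys_iff)
      then show ?thesis using le[OF a, of v] le[OF b, of v] by simp
    qed
  qed
  ultimately have A: "finite ?A"
    by (rule finite_imageD)
  have "{(a, b). a + b = m} \<subseteq> (\<lambda>a. (a, m - a)) ` ?A"
    by (auto simp: image_iff)
  then show ?thesis
    using A finite_subset by blast
qed

instantiation mps :: (type, comm_ring_1) comm_ring_1
begin

definition "0 = Abs_mps (\<lambda>_. 0)"
definition "1 = Abs_mps (\<lambda>m. if m = 0 then 1 else 0)"
definition "F + G = Abs_mps (\<lambda>m. mps_coeff F m + mps_coeff G m)"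
definition "- F = Abs_mps (\<lambda>m. - mps_coeff F m)"
definition "F - G = Abs_mps (\<lambda>m. mps_coeff F m - mps_coeff G m)"
definition "F * G = Abs_mps (\<lambda>m. \<Sum>(a, b) | a + b = m. mps_coeff F a * mps_coeff G b)"

instance
proof
  fix F G H :: "('a, 'b) mps"
  note defs = zero_mps_def one_mps_def plus_mps_def uminus_mps_def minus_mps_def times_mps_def
  show "F + G + H = F + (G + H)" "F + G = G + F" "0 + F = F" "- F + F = 0" "F - G = F + - G"
    by (simp_all add: defs algebra_simps mps_coeff_inverse)
  show "F * G = G * F"
  proof (rule mps_eqI)
    fix m
    show "mps_coeff (F * G) m = mps_coeff (G * F) m"
      unfolding times_mps_def mps_coeff_Abs
      by (rule sum.reindex_bij_witness[where i = prod.swap and j = prod.swap])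
        (auto simp: algebra_simps)
  qed
  show "(F + G) * H = F * H + G * H"
    by (rule mps_eqI)
      (simp add: times_mps_def plus_mps_def algebra_simps case_prod_unfold sum.distrib)
  show "1 * F = F"
  proof (rule mps_eqI)
    fix m
    have "mps_coeff (1 * F) m
        = (\<Sum>(a, b) | a + b = m. (if a = 0 then 1 else 0) * mps_coeff F b)"
      by (simp add: times_mps_def one_mps_def)
    also have "\<dots> = (\<Sum>(a, b)\<in>{(0 :: 'a \<Rightarrow>\<^sub>0 nat, m)}.
        (if a = 0 then 1 else 0) * mps_coeff F b)"
      by (rule sum.mono_neutral_right) (auto simp: finite_add_decompositions split: if_splits)
    finally show "mps_coeff (1 * F) m = mps_coeff F m" by simp
  qed
  show "(0 :: ('a, 'b) mps) \<noteq> 1"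
  proof
    assume "(0 :: ('a, 'b) mps) = 1"
    then have "mps_coeff (0 :: ('a, 'b) mps) 0 = mps_coeff 1 0" by simp
    then show False by (simp add: zero_mps_def one_mps_def)
  qed
  show "F * G * H = F * (G * H)"
  proof (rule mps_eqI)
    fix m
    let ?f = "mps_coeff F" and ?g = "mps_coeff G" and ?h = "mps_coeff H"
    have "mps_coeff (F * G * H) m
        = (\<Sum>p | fst p + snd p = m. \<Sum>q | fst q + snd q = fst p. ?f (fst q) * ?g (snd q) * ?h (snd p))"
      by (simp add: times_mps_def case_prod_unfold sum_distrib_right)
    also have "\<dots> = (\<Sum>(p, q)\<in>(SIGMA p:{p. fst p + snd p = m}. {q. fst q + snd q = fst p}).
        ?f (fst q) * ?g (snd q) * ?h (snd p))"
      using finite_add_decompositions by (subst sum.Sigma) (auto simp: case_prod_unfold)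
    also have "\<dots> = (\<Sum>(p, q)\<in>(SIGMA p:{p. fst p + snd p = m}. {q. fst q + snd q = snd p}).
        ?f (fst p) * (?g (fst q) * ?h (snd q)))"
      by (rule sum.reindex_bij_witness[where
          i = "\<lambda>((a, _), (b, c)). ((a + b, c), (a, b))" and
          j = "\<lambda>((_, c), (a, b)). ((a, b + c), (b, c))"])
        (auto simp: algebra_simps)
    also have "\<dots> = (\<Sum>p | fst p + snd p = m. \<Sum>q | fst q + snd q = snd p.
        ?f (fst p) * (?g (fst q) * ?h (snd q)))"
      using finite_add_decompositions by (subst sum.Sigma) (auto simp: case_prod_unfold)
    also have "\<dots> = mps_coeff (F * (G * H)) m"
      by (simp add: times_mps_def case_prod_unfold sum_distrib_left)
    finally show "mps_coeff (F * G * H) m = mps_coeff (F * (G * H)) m" .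
  qed
qed

end

definition mps_X :: "'v \<Rightarrow> ('v, 'a :: comm_ring_1) mps" where
  "mps_X v = Abs_mps (\<lambda>m. if m = Poly_Mapping.single v 1 then 1 else 0)"

definition mps_pderiv :: "'v \<Rightarrow> ('v, 'a :: comm_ring_1) mps \<Rightarrow> ('v, 'a) mps" where
  "mps_pderiv v F = Abs_mps (\<lambda>m.
     of_nat (Poly_Mapping.lookup m v + 1) * mps_coeff F (m + Poly_Mapping.single v 1))"

text \<open>Substitution of the series \<open>\<phi> v\<close> for the variables \<open>v\<close>.  Each coefficient is a sum over all
  monomials \<open>a\<close> of \<open>F\<close>; \<^const>\<open>Sum_any\<close> is the sum of the nonzero terms, and \<open>0\<close> if there are
  infinitely many of them.  There are only finitely many when \<open>F\<close> involves finitely many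
  variables, and the series substituted for these have no constant terms.\<close>

definition mps_subst :: "('v \<Rightarrow> ('w, 'a :: comm_ring_1) mps) \<Rightarrow> ('v, 'a) mps \<Rightarrow> ('w, 'a) mps" where
  "mps_subst \<phi> F = Abs_mps (\<lambda>m. Sum_any (\<lambda>a.
     mps_coeff F a * mps_coeff (\<Prod>v\<in>Poly_Mapping.keys a. \<phi> v ^ Poly_Mapping.lookup a v) m))"

definition mps_over :: "'v set \<Rightarrow> ('v, 'a :: zero) mps set" where
  "mps_over V = {F. \<forall>m. mps_coeff F m \<noteq> 0 \<longrightarrow> Poly_Mapping.keys m \<subseteq> V}"

definition no_constant_term :: "('v, 'a :: zero) mps \<Rightarrow> bool" where
  "no_constant_term F \<longleftrightarrow> mps_coeff F 0 = 0"

definition no_linear_terms :: "('v, 'a :: zero) mps \<Rightarrow> bool" where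
  "no_linear_terms F \<longleftrightarrow> (\<forall>v. mps_coeff F (Poly_Mapping.single v 1) = 0)"


section \<open>Series in \<open>(z, zbar, u)\<close>\<close>

datatype coord = ZVar nat | ZbarVar nat | UVar nat

type_synonym series = "(coord, complex) mps"

definition coords :: "nat \<Rightarrow> nat \<Rightarrow> coord set" where
  "coords n d = ZVar ` {..<n} \<union> ZbarVar ` {..<n} \<union> UVar ` {..<d}"

fun conj_coord :: "coord \<Rightarrow> coord" where
  "conj_coord (ZVar j) = ZbarVar j"
| "conj_coord (ZbarVar j) = ZVar j"
| "conj_coord (UVar j) = UVar j"

lemma conj_coord_conj_coord [simp]: "conj_coord (conj_coord v) = v"
  by (cases v) simp_all

lemma inj_conj_coord: "inj conj_coord"
  by (metis injI conj_coord_conj_coord)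

lemma lookup_map_key_conj_coord [simp]:
  "Poly_Mapping.lookup (Poly_Mapping.map_key conj_coord m) v
     = Poly_Mapping.lookup m (conj_coord v)"
  by (simp add: map_key.rep_eq[OF inj_conj_coord])

definition series_cnj :: "series \<Rightarrow> series" where
  "series_cnj F = Abs_mps (\<lambda>m. cnj (mps_coeff F (Poly_Mapping.map_key conj_coord m)))"

definition series_Re :: "series \<Rightarrow> series" where
  "series_Re F = Abs_mps (\<lambda>m. (mps_coeff F m + mps_coeff (series_cnj F) m) / 2)"

definition real_valued :: "series \<Rightarrow> bool" where
  "real_valued F \<longleftrightarrow> series_cnj F = F"

text \<open>\<open>k\<close>-tuples of series in the variables \<open>V\<close> without constant and linear terms.\<close>

definition higher_order_vec :: "nat \<Rightarrow> coord set \<Rightarrow> series vec set" where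
  "higher_order_vec k V = {f \<in> carrier_vec k. \<forall>i<k.
     f $ i \<in> mps_over V \<and> no_constant_term (f $ i) \<and> no_linear_terms (f $ i)}"

text \<open>\<open>f(z, 0, u)\<close> and \<open>g(0, 0, u)\<close>.\<close>

definition at_zbar_0 :: "series vec \<Rightarrow> series vec" where
  "at_zbar_0 = map_vec (mps_subst (\<lambda>v. case v of
     ZVar j \<Rightarrow> mps_X (ZVar j) | ZbarVar j \<Rightarrow> 0 | UVar j \<Rightarrow> mps_X (UVar j)))"

definition at_z_zbar_0 :: "series vec \<Rightarrow> series vec" where
  "at_z_zbar_0 = map_vec (mps_subst (\<lambda>v. case v of
     ZVar j \<Rightarrow> 0 | ZbarVar j \<Rightarrow> 0 | UVar j \<Rightarrow> mps_X (UVar j)))"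


section \<open>Formal almost CR structures\<close>

text \<open>The two blocks of \<open>L = (Lzb, Lw)\<close> are given by their matrices in the standard bases.\<close>

definition formal_almost_CR :: "nat \<Rightarrow> nat \<Rightarrow> series mat \<Rightarrow> series mat \<Rightarrow> bool" where
  "formal_almost_CR n d Lzb Lw \<longleftrightarrow>
     Lzb \<in> carrier_mat n n \<and> Lw \<in> carrier_mat d n \<and>
     (\<forall>F \<in> elements_mat Lzb \<union> elements_mat Lw. F \<in> mps_over (coords n d) \<and> no_constant_term F)"

definition jac :: "(nat \<Rightarrow> coord) \<Rightarrow> nat \<Rightarrow> series vec \<Rightarrow> series mat" where
  "jac x k f = mat (dim_vec f) k (\<lambda>(i, j). mps_pderiv (x j) (f $ i))"

text \<open>Composition of \<open>F\<close> with \<open>(z, zbar, u) + (f, fbar, g)(z, zbar, u)\<close>.  Entries of \<open>f\<close>, \<open>g\<close> with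
  an index beyond the dimension play no role for \<open>F\<close> in \<open>mps_over (coords n d)\<close>.\<close>

definition compose_id_plus :: "series vec \<Rightarrow> series vec \<Rightarrow> series \<Rightarrow> series" where
  "compose_id_plus f g = mps_subst (\<lambda>v. case v of
     ZVar j \<Rightarrow> mps_X (ZVar j) + f $ j
   | ZbarVar j \<Rightarrow> mps_X (ZbarVar j) + series_cnj (f $ j)
   | UVar j \<Rightarrow> mps_X (UVar j) + g $ j)"

definition transforms :: "nat \<Rightarrow> nat \<Rightarrow> series vec \<Rightarrow> series vec \<Rightarrow>
    series mat \<Rightarrow> series mat \<Rightarrow> series mat \<Rightarrow> series mat \<Rightarrow> bool" where
  "transforms n d f g Lzb Lw Lzb' Lw' \<longleftrightarrow>
    (let fb = map_vec series_cnj f;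
         T = 1\<^sub>m n + jac ZVar n f + jac ZbarVar n f * Lzb + jac UVar d f * Lw
     in jac ZVar n g + jac ZbarVar n g * Lzb + (1\<^sub>m d + jac UVar d g) * Lw
          = map_mat (compose_id_plus f g) Lw' * T \<and>
        jac ZVar n fb + (1\<^sub>m n + jac ZbarVar n fb) * Lzb + jac UVar d fb * Lw
          = map_mat (compose_id_plus f g) Lzb' * T)"

text \<open>Evaluation along the Euler vector field \<open>\<Sum>j. z\<^sub>j \<partial>/\<partial>z\<^sub>j\<close>.\<close>

definition euler_eval :: "nat \<Rightarrow> series mat \<Rightarrow> series vec" where
  "euler_eval n A = A *\<^sub>v vec n (\<lambda>j. mps_X (ZVar j))"

end

theory Submission
  imports Defs
begin

text \<open>Write \<open>\<phi>\<close> for the map \<open>id + (f, g)\<close>.  The matrices of \<open>L' \<circ> \<phi>\<close> are \<open>K = (derivatives of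
  fbar resp. g, plus L) (1 + D f)\<^sup>-\<^sup>1\<close>, and since \<open>\<phi>\<close> is real, the normalization says
  \<open>K (z + f) = 0\<close> for the first block and \<open>Re (K (z + f)) = 0\<close> for the second.  The parts of these
  equations that are linear in \<open>fbar\<close> and \<open>g\<close> with constant coefficients are the Euler operator
  \<open>\<Sum> z\<^sub>j \<partial>/\<partial>z\<^sub>j\<close> applied to \<open>fbar\<close> and half of \<open>\<Sum> (z\<^sub>j \<partial>/\<partial>z\<^sub>j + zbar\<^sub>j \<partial>/\<partial>zbar\<^sub>j)\<close> applied to \<open>g\<close>,
  and every other term of degree \<open>m\<close> only involves \<open>f\<close>, \<open>g\<close> in degrees below \<open>m\<close>.  Both operators are
  diagonal on monomials, with kernels parametrized by \<open>f\<^sub>0\<close> and \<open>g\<^sub>0\<close>, so the components of the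
  equations outside the cokernel amount to a fixed point equation for a contraction in the degree
  filtration, first for \<open>f\<close> and then for \<open>g\<close>.

  The components in the cokernel hold automatically: \<open>L' z'\<close> has none, as it vanishes for \<open>z' = 0\<close>, and
  composition with \<open>\<phi>\<close> does not change the lowest order part of a series.\<close>

section \<open>The degree filtration\<close>

lemma mps_coeff_zero [simp]: "mps_coeff 0 m = 0"
  by (simp add: zero_mps_def)

lemma mps_coeff_one: "mps_coeff 1 m = (if m = 0 then 1 else 0)"
  by (simp add: one_mps_def)

lemma mps_coeff_add [simp]: "mps_coeff (F + G) m = mps_coeff F m + mps_coeff G m"
  by (simp add: plus_mps_def)

lemma mps_coeff_uminus [simp]: "mps_coeff (- F) m = - mps_coeff F m"
  by (simp add: uminus_mps_def)

lemma mps_coeff_diff [simp]: "mps_coeff (F - G) m = mps_coeff F m - mps_coeff G m"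
  by (simp add: minus_mps_def)

lemma mps_coeff_mult:
  "mps_coeff (F * G) m = (\<Sum>(a, b) | a + b = m. mps_coeff F a * mps_coeff G b)"
  by (simp add: times_mps_def)

lemma mps_coeff_sum [simp]: "mps_coeff (sum f A) m = (\<Sum>x\<in>A. mps_coeff (f x) m)"
  by (induction A rule: infinite_finite_induct) auto

lemma mps_coeff_X: "mps_coeff (mps_X v) m = (if m = Poly_Mapping.single v 1 then 1 else 0)"
  by (simp add: mps_X_def)

lemma mps_coeff_mult_X:
  "mps_coeff (F * mps_X v) m =
     (if Poly_Mapping.lookup m v = 0 then 0 else mps_coeff F (m - Poly_Mapping.single v 1))"
proof -
  let ?s = "Poly_Mapping.single v (1::nat)"
  have "mps_coeff (F * mps_X v) m =
      (\<Sum>(a, b) \<in> (if Poly_Mapping.lookup m v = 0 then {} else {(m - ?s, ?s)}).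
         mps_coeff F a * mps_coeff (mps_X v) b)"
    unfolding mps_coeff_mult
  proof (rule sum.mono_neutral_right)
    show "(if Poly_Mapping.lookup m v = 0 then {} else {(m - ?s, ?s)}) \<subseteq> {(a, b). a + b = m}"
      by (auto intro!: poly_mapping_eqI simp: lookup_add lookup_minus lookup_single when_def)
  qed (auto simp: finite_add_decompositions mps_coeff_X lookup_add split: if_splits)
  then show ?thesis by (simp add: mps_coeff_X)
qed

section \<open>Monomials and their total degree\<close>

definition mono_deg :: "('v \<Rightarrow>\<^sub>0 nat) \<Rightarrow> nat" where
  "mono_deg m = (\<Sum>v\<in>Poly_Mapping.keys m. Poly_Mapping.lookup m v)"

lemma mono_deg_superset:
  assumes "finite V" "Poly_Mapping.keys m \<subseteq> V"
  shows "mono_deg m = (\<Sum>v\<in>V. Poly_Mapping.lookup m v)"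
  unfolding mono_deg_def using assms by (intro sum.mono_neutral_left) (auto simp: in_keys_iff)

text \<open>Natural exponents cannot cancel, so no variable disappears in a product of
  monomials.\<close>

lemma keys_add_nat:
  "Poly_Mapping.keys (a + b :: 'v \<Rightarrow>\<^sub>0 nat) = Poly_Mapping.keys a \<union> Poly_Mapping.keys b"
  by (auto simp: in_keys_iff lookup_add)

lemma mono_deg_add [simp]: "mono_deg (a + b) = mono_deg a + mono_deg b"
proof -
  let ?V = "Poly_Mapping.keys a \<union> Poly_Mapping.keys b"
  have "mono_deg a = (\<Sum>v\<in>?V. Poly_Mapping.lookup a v)"
    "mono_deg b = (\<Sum>v\<in>?V. Poly_Mapping.lookup b v)"
    "mono_deg (a + b) = (\<Sum>v\<in>?V. Poly_Mapping.lookup (a + b) v)"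
    by (rule mono_deg_superset; auto simp: keys_add_nat)+
  then show ?thesis by (simp add: lookup_add sum.distrib)
qed

lemma mono_deg_single [simp]: "mono_deg (Poly_Mapping.single v k) = k"
  by (simp add: mono_deg_def)

lemma mono_deg_zero [simp]: "mono_deg 0 = 0"
  by (simp add: mono_deg_def)

lemma mono_deg_eq_0_iff [simp]: "mono_deg m = 0 \<longleftrightarrow> m = 0"
  by (auto simp: mono_deg_def in_keys_iff intro!: poly_mapping_eqI)

lemma mono_decompose:
  fixes a :: "'v \<Rightarrow>\<^sub>0 nat"
  assumes "v \<in> Poly_Mapping.keys a"
  shows "a = (a - Poly_Mapping.single v 1) + Poly_Mapping.single v 1"
  using assms
  by (auto intro!: poly_mapping_eqI simp: lookup_add lookup_minus lookup_single when_def in_keys_iff)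

text \<open>Induction on the total degree, splitting off one variable of the support at a
  time.\<close>

lemma mono_induct [case_names zero single]:
  fixes a :: "'v \<Rightarrow>\<^sub>0 nat"
  assumes "P 0" "\<And>a v. P a \<Longrightarrow> P (a + Poly_Mapping.single v 1)"
  shows "P a"
proof (induction "mono_deg a" arbitrary: a)
  case 0
  then show ?case using assms(1) by simp
next
  case (Suc k)
  then have "a \<noteq> 0" by auto
  then obtain v where v: "v \<in> Poly_Mapping.keys a" by fastforce
  let ?b = "a - Poly_Mapping.single v 1"
  have a: "a = ?b + Poly_Mapping.single v 1" by (rule mono_decompose[OF v])
  from arg_cong[OF a, of mono_deg] Suc(2) have "k = mono_deg ?b" by simp
  then show ?case using Suc(1) assms(2) a by metis
qed

section \<open>The filtration by order of vanishing\<close>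

text \<open>Over a ring and for finite \<open>V\<close>, this is the \<open>k\<close>th power of the
  ideal generated by the variables; \<open>k = 0\<close> gives \<open>mps_over V\<close>. Building
  the support condition in lets every order estimate also keep track of the variables.\<close>

definition mps_ideal :: "'v set \<Rightarrow> nat \<Rightarrow> ('v, 'a :: zero) mps set" where
  "mps_ideal V k = {F \<in> mps_over V. \<forall>m. mono_deg m < k \<longrightarrow> mps_coeff F m = 0}"

lemma mps_ideal_iff:
  "F \<in> mps_ideal V k \<longleftrightarrow>
     (\<forall>m. mps_coeff F m \<noteq> 0 \<longrightarrow> Poly_Mapping.keys m \<subseteq> V \<and> k \<le> mono_deg m)"
  unfolding mps_ideal_def mps_over_def by (auto simp: not_less)

lemma mps_over_ideal: "F \<in> mps_ideal V k \<Longrightarrow> F \<in> mps_over V"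
  by (simp add: mps_ideal_def)

lemma mps_ideal_zero [simp]: "0 \<in> mps_ideal V k"
  by (simp add: mps_ideal_iff)

lemma mps_ideal_add: "F \<in> mps_ideal V k \<Longrightarrow> G \<in> mps_ideal V k \<Longrightarrow> F + G \<in> mps_ideal V k"
  unfolding mps_ideal_iff by (metis add_0 mps_coeff_add)

lemma mps_ideal_uminus: "F \<in> mps_ideal V k \<Longrightarrow> - F \<in> mps_ideal V k"
  unfolding mps_ideal_iff by simp

lemma mps_ideal_diff: "F \<in> mps_ideal V k \<Longrightarrow> G \<in> mps_ideal V k \<Longrightarrow> F - G \<in> mps_ideal V k"
  unfolding mps_ideal_iff by (metis diff_zero mps_coeff_diff)

lemma mps_ideal_sum: "(\<And>x. x \<in> A \<Longrightarrow> f x \<in> mps_ideal V k) \<Longrightarrow> sum f A \<in> mps_ideal V k"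
  by (induction A rule: infinite_finite_induct) (auto intro: mps_ideal_add)

lemma mps_ideal_antimono: "F \<in> mps_ideal V k \<Longrightarrow> j \<le> k \<Longrightarrow> F \<in> mps_ideal V j"
  unfolding mps_ideal_iff by (meson order_trans)

lemma mps_ideal_mult:
  assumes F: "F \<in> mps_ideal V j" and G: "G \<in> mps_ideal V k"
  shows "F * G \<in> mps_ideal V (j + k)"
  unfolding mps_ideal_iff
proof (intro allI impI)
  fix m
  assume "mps_coeff (F * G) m \<noteq> 0"
  then obtain a b where ab: "a + b = m" "mps_coeff F a * mps_coeff G b \<noteq> 0"
    unfolding mps_coeff_mult by (force elim: sum.not_neutral_contains_not_neutral)
  then have "mps_coeff F a \<noteq> 0" "mps_coeff G b \<noteq> 0" by auto
  then have "Poly_Mapping.keys a \<subseteq> V \<and> j \<le> mono_deg a"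
    "Poly_Mapping.keys b \<subseteq> V \<and> k \<le> mono_deg b"
    using F G unfolding mps_ideal_iff by blast+
  then show "Poly_Mapping.keys m \<subseteq> V \<and> j + k \<le> mono_deg m"
    using ab(1) by (auto simp: keys_add_nat)
qed

lemma mps_ideal_one: "1 \<in> mps_ideal V 0"
  by (auto simp: mps_ideal_iff mps_coeff_one)

lemma mps_ideal_X: "v \<in> V \<Longrightarrow> mps_X v \<in> mps_ideal V 1"
  by (auto simp: mps_ideal_iff mps_coeff_X split: if_splits)

lemma mps_ideal_pderiv:
  assumes "F \<in> mps_ideal V (Suc k)"
  shows "mps_pderiv v F \<in> mps_ideal V k"
  unfolding mps_ideal_iff
proof (intro allI impI)
  fix m
  assume "mps_coeff (mps_pderiv v F) m \<noteq> 0"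
  then have "mps_coeff F (m + Poly_Mapping.single v 1) \<noteq> 0"
    by (auto simp: mps_pderiv_def)
  then show "Poly_Mapping.keys m \<subseteq> V \<and> k \<le> mono_deg m"
    using assms unfolding mps_ideal_iff by (force simp: keys_add_nat)
qed

lemma mps_pderiv_diff: "mps_pderiv v (F - G) = mps_pderiv v F - mps_pderiv v G"
  by (rule mps_eqI) (simp add: mps_pderiv_def algebra_simps)

text \<open>The filtration is separated: membership for \<open>k = mono_deg m + 1\<close> kills the
  coefficient at \<open>m\<close>. All uniqueness arguments end here.\<close>

lemma mps_ideal_Inter_eq_zero: "(\<And>k. F \<in> mps_ideal V k) \<Longrightarrow> F = 0"
  by (rule mps_eqI) (metis mps_coeff_zero mps_ideal_iff not_less_eq_eq order_refl)

lemma mps_ideal_diff_trans: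
  "F - G \<in> mps_ideal V k \<Longrightarrow> G - H \<in> mps_ideal V k \<Longrightarrow> F - H \<in> mps_ideal V k"
  using mps_ideal_add[of "F - G" V k "G - H"] by simp

lemma mps_ideal_1_iff: "F \<in> mps_ideal V 1 \<longleftrightarrow> F \<in> mps_over V \<and> no_constant_term F"
  by (auto simp: mps_ideal_def no_constant_term_def)

lemma mps_ideal_2_iff:
  "F \<in> mps_ideal V 2 \<longleftrightarrow> F \<in> mps_over V \<and> no_constant_term F \<and> no_linear_terms F"
proof -
  have "mono_deg m < 2 \<longleftrightarrow> m = 0 \<or> (\<exists>v. m = Poly_Mapping.single v 1)" for m :: "'a \<Rightarrow>\<^sub>0 nat"
  proof
    assume m: "mono_deg m < 2"
    show "m = 0 \<or> (\<exists>v. m = Poly_Mapping.single v 1)"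
    proof (cases "m = 0")
      case False
      then obtain v where v: "v \<in> Poly_Mapping.keys m" by fastforce
      let ?b = "m - Poly_Mapping.single v 1"
      have eq: "m = ?b + Poly_Mapping.single v 1" by (rule mono_decompose[OF v])
      from arg_cong[OF eq, of mono_deg] m have "mono_deg ?b = 0" by simp
      then show ?thesis using eq by (metis add_0 mono_deg_eq_0_iff)
    qed simp
  qed auto
  then show ?thesis
    by (auto simp: mps_ideal_def no_constant_term_def no_linear_terms_def)
qed

text \<open>The fixed point is read off degree by degree from the iterates of \<open>\<Phi>\<close>: the
  coefficients of degree \<open>j\<close> do not change after step \<open>j + 1\<close>.\<close>

lemma contraction_fixpoint:
  fixes \<Phi> :: "('i \<Rightarrow> ('v, 'a :: comm_ring_1) mps) \<Rightarrow> 'i \<Rightarrow> ('v, 'a) mps"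
  assumes closed: "\<And>x i. (\<And>i. x i \<in> mps_ideal V k) \<Longrightarrow> \<Phi> x i \<in> mps_ideal V k"
    and contr: "\<And>x y j i. (\<And>i. x i \<in> mps_ideal V k) \<Longrightarrow> (\<And>i. y i \<in> mps_ideal V k) \<Longrightarrow>
      (\<And>i. x i - y i \<in> mps_ideal V j) \<Longrightarrow> \<Phi> x i - \<Phi> y i \<in> mps_ideal V (Suc j)"
  obtains x where "\<And>i. x i \<in> mps_ideal V k" "\<Phi> x = x"
proof -
  define it where "it j = (\<Phi> ^^ j) (\<lambda>_. 0)" for j
  have it_Suc: "it (Suc j) = \<Phi> (it j)" for j by (simp add: it_def)
  have it_closed: "it j i \<in> mps_ideal V k" for j i
    by (induction j arbitrary: i) (auto simp: it_Suc closed, simp add: it_def)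
  have step: "it (Suc j) i - it j i \<in> mps_ideal V j" for j i
  proof (induction j arbitrary: i)
    case 0
    have "F \<in> mps_ideal V 0" if "F \<in> mps_ideal V k" for F :: "('v, 'a) mps"
      using that mps_ideal_antimono by blast
    then show ?case by (intro mps_ideal_diff it_closed) (auto simp: it_closed)
  next
    case (Suc j)
    show ?case unfolding it_Suc[of "Suc j"]
      by (subst (2) it_Suc, rule contr) (auto simp: it_closed Suc.IH)
  qed
  have steps: "it (j + l) i - it j i \<in> mps_ideal V j" for j l i
  proof (induction l)
    case (Suc l)
    have "it (Suc (j + l)) i - it (j + l) i \<in> mps_ideal V j"
      by (rule mps_ideal_antimono[OF step]) simp
    with Suc show ?case by (simp add: mps_ideal_diff_trans)
  qed simp
  define x where "x i = Abs_mps (\<lambda>m. mps_coeff (it (Suc (mono_deg m)) i) m)" for i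
  have x_closed: "x i \<in> mps_ideal V k" for i
    using it_closed unfolding mps_ideal_iff x_def by auto
  have x_it: "x i - it j i \<in> mps_ideal V j" for i j
    unfolding mps_ideal_iff
  proof (intro allI impI)
    fix m
    assume nz: "mps_coeff (x i - it j i) m \<noteq> 0"
    have "Poly_Mapping.keys m \<subseteq> V"
      using nz mps_ideal_diff[OF x_closed it_closed] unfolding mps_ideal_iff by blast
    moreover have "j \<le> mono_deg m"
    proof (rule ccontr)
      assume "\<not> j \<le> mono_deg m"
      then obtain l where "j = Suc (mono_deg m) + l"
        by (metis add_Suc less_iff_Suc_add not_le)
      then have "mps_coeff (it j i - it (Suc (mono_deg m)) i) m = 0"
        using steps[of "Suc (mono_deg m)" l i] unfolding mps_ideal_iff by fastforce
      then show False using nz by (simp add: x_def)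
    qed
    ultimately show "Poly_Mapping.keys m \<subseteq> V \<and> j \<le> mono_deg m" by simp
  qed
  have "\<Phi> x i = x i" for i
  proof -
    \<comment> \<open>Below degree \<open>Suc j\<close>, both \<open>\<Phi> x\<close> and
      \<open>x\<close> agree with \<open>it (Suc j)\<close>: the former because
      \<open>\<Phi>\<close> gains one order over \<open>x - it j\<close>.\<close>
    have "\<Phi> x i - x i \<in> mps_ideal V j" for j
    proof -
      have "\<Phi> x i - it (Suc j) i \<in> mps_ideal V (Suc j)"
        unfolding it_Suc by (intro contr x_closed it_closed x_it)
      moreover have "it (Suc j) i - x i \<in> mps_ideal V (Suc j)"
        using mps_ideal_uminus[OF x_it[of i "Suc j"]] by simp
      ultimately have "\<Phi> x i - x i \<in> mps_ideal V (Suc j)" by (rule mps_ideal_diff_trans)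
      then show ?thesis by (rule mps_ideal_antimono) simp
    qed
    then show ?thesis using mps_ideal_Inter_eq_zero[of "\<Phi> x i - x i" V] by simp
  qed
  then show ?thesis using that x_closed by blast
qed

section \<open>Substitution of near-identity series\<close>

definition mono_subst :: "('v \<Rightarrow> ('w, 'a :: comm_ring_1) mps) \<Rightarrow> ('v \<Rightarrow>\<^sub>0 nat) \<Rightarrow> ('w, 'a) mps" where
  "mono_subst \<phi> a = (\<Prod>v\<in>Poly_Mapping.keys a. \<phi> v ^ Poly_Mapping.lookup a v)"

lemma mono_subst_zero [simp]: "mono_subst \<phi> 0 = 1"
  by (simp add: mono_subst_def)

lemma mono_subst_single [simp]: "mono_subst \<phi> (Poly_Mapping.single v (Suc 0)) = \<phi> v"
  by (simp add: mono_subst_def)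

lemma mono_subst_add: "mono_subst \<phi> (a + b) = mono_subst \<phi> a * mono_subst \<phi> b"
proof -
  let ?V = "Poly_Mapping.keys a \<union> Poly_Mapping.keys b"
  have *: "mono_subst \<phi> c = (\<Prod>v\<in>?V. \<phi> v ^ Poly_Mapping.lookup c v)"
    if "Poly_Mapping.keys c \<subseteq> ?V" for c
    unfolding mono_subst_def using that by (intro prod.mono_neutral_left) (auto simp: in_keys_iff)
  show ?thesis
    by (subst (1 2 3) *) (auto simp: keys_add_nat lookup_add power_add prod.distrib)
qed

lemma mps_coeff_mono_subst_X:
  "mps_coeff (mono_subst mps_X a) m = (if m = a then 1 else 0)"
proof (induction a arbitrary: m rule: mono_induct)
  case zero
  then show ?case by (simp add: mps_coeff_one)
next
  case (single a v)
  show ?case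
  proof (cases "Poly_Mapping.lookup m v = 0")
    case True
    then show ?thesis by (auto simp: mono_subst_add mps_coeff_mult_X lookup_add)
  next
    case False
    then have m: "m = (m - Poly_Mapping.single v 1) + Poly_Mapping.single v 1"
      by (intro mono_decompose) (simp add: in_keys_iff)
    then have "m - Poly_Mapping.single v 1 = a \<longleftrightarrow> m = a + Poly_Mapping.single v 1"
      by auto
    then show ?thesis using False single by (simp add: mono_subst_add mps_coeff_mult_X)
  qed
qed

text \<open>Setting variables to zero kills the monomials that involve them and fixes the others, so
  the \<open>Sum_any\<close> at \<open>m\<close> can only contain the term \<open>a = m\<close>.
  Both \<open>at_zbar_0\<close> and \<open>at_z_zbar_0\<close> are substitutions of this
  kind.\<close>

lemma mps_coeff_subst_restrict:
  fixes F :: "('v, 'a :: comm_ring_1) mps"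
  shows "mps_coeff (mps_subst (\<lambda>v. if v \<in> W then mps_X v else 0) F) m =
     (if Poly_Mapping.keys m \<subseteq> W then mps_coeff F m else 0)"
proof -
  let ?\<phi> = "\<lambda>v. if v \<in> W then mps_X v else (0 :: ('v, 'a) mps)"
  have "mono_subst ?\<phi> a = (if Poly_Mapping.keys a \<subseteq> W then mono_subst mps_X a else 0)" for a
  proof (cases "Poly_Mapping.keys a \<subseteq> W")
    case True
    then show ?thesis unfolding mono_subst_def by (auto intro!: prod.cong)
  next
    case False
    then obtain v where "v \<in> Poly_Mapping.keys a" "v \<notin> W" by blast
    then have "\<exists>v\<in>Poly_Mapping.keys a. ?\<phi> v ^ Poly_Mapping.lookup a v = 0"
      by (intro bexI[of _ v]) (auto simp: in_keys_iff power_0_left)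
    then show ?thesis using False unfolding mono_subst_def by (simp add: prod_zero)
  qed
  then have "mps_coeff F a * mps_coeff (mono_subst ?\<phi> a) m =
      ((if Poly_Mapping.keys m \<subseteq> W then mps_coeff F m else 0) when a = m)" for a
    by (auto simp: mps_coeff_mono_subst_X when_def)
  then show ?thesis unfolding mps_subst_def mono_subst_def[symmetric] by simp
qed

lemma finite_monos_le:
  assumes "finite V"
  shows "finite {a :: 'v \<Rightarrow>\<^sub>0 nat. Poly_Mapping.keys a \<subseteq> V \<and> mono_deg a \<le> k}"
proof -
  \<comment> \<open>Every monomial of degree at most \<open>k\<close> in \<open>V\<close> divides
    \<open>b\<close>, the product of all \<open>v ^ k\<close>, so finiteness follows from that of
    the decompositions of \<open>b\<close>.\<close>
  define b where "b = (\<Sum>v\<in>V. Poly_Mapping.single v k)"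
  have "a + (b - a) = b" if a: "Poly_Mapping.keys a \<subseteq> V" "mono_deg a \<le> k" for a
  proof (rule poly_mapping_eqI)
    fix v
    have "Poly_Mapping.lookup a v \<le> Poly_Mapping.lookup b v"
    proof (cases "v \<in> V")
      case True
      have "Poly_Mapping.lookup b v = k"
        using True assms by (simp add: b_def lookup_sum lookup_single when_def)
      moreover have "Poly_Mapping.lookup a v \<le> mono_deg a"
        unfolding mono_deg_superset[OF assms a(1)] using True assms by (intro member_le_sum) auto
      ultimately show ?thesis using a(2) by simp
    next
      case False
      then have "v \<notin> Poly_Mapping.keys a" using a(1) by blast
      then show ?thesis by (simp add: in_keys_iff)
    qed
    then show "Poly_Mapping.lookup (a + (b - a)) v = Poly_Mapping.lookup b v"
      by (simp add: lookup_add lookup_minus)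
  qed
  then have "{a. Poly_Mapping.keys a \<subseteq> V \<and> mono_deg a \<le> k} \<subseteq> fst ` {(a, c). a + c = b}"
    by force
  then show ?thesis using finite_add_decompositions finite_subset finite_imageI by blast
qed

text \<open>Order 2 says that the map fixes the origin and is tangent to the identity there. The
  first makes substitution a finite sum in each degree, the second makes it act trivially on lowest
  order terms.\<close>

locale near_identity =
  fixes V :: "'v set" and \<phi> :: "'v \<Rightarrow> ('v, 'a :: comm_ring_1) mps"
  assumes finite_V: "finite V"
    and near: "v \<in> V \<Longrightarrow> \<phi> v - mps_X v \<in> mps_ideal V 2"
begin

lemma subst_var_ideal: "v \<in> V \<Longrightarrow> \<phi> v \<in> mps_ideal V 1"
  using mps_ideal_add[OF mps_ideal_antimono[OF near, of v 1] mps_ideal_X, of v] by simp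

lemma mono_subst_ideal:
  assumes "Poly_Mapping.keys a \<subseteq> V"
  shows "mono_subst \<phi> a \<in> mps_ideal V (mono_deg a)"
  using assms
proof (induction a rule: mono_induct)
  case zero
  then show ?case by (simp add: mps_ideal_one)
next
  case (single a v)
  then show ?case
    using mps_ideal_mult[of "mono_subst \<phi> a" V "mono_deg a" "\<phi> v" 1] subst_var_ideal
    by (auto simp: mono_subst_add keys_add_nat)
qed

lemma mono_subst_near:
  assumes "Poly_Mapping.keys a \<subseteq> V"
  shows "mono_subst \<phi> a - mono_subst mps_X a \<in> mps_ideal V (Suc (mono_deg a))"
  using assms
proof (induction a rule: mono_induct)
  case (single a v)
  then have v: "v \<in> V" and a: "Poly_Mapping.keys a \<subseteq> V" by (auto simp: keys_add_nat)
  have X: "mono_subst mps_X a \<in> mps_ideal V (mono_deg a)"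
    using a by (auto simp: mps_ideal_iff mps_coeff_mono_subst_X split: if_splits)
  \<comment> \<open>Telescoping: exchanging one factor at a time, either the induction hypothesis or
    \<open>near\<close> supplies the extra order.\<close>
  have "mono_subst \<phi> (a + Poly_Mapping.single v 1) - mono_subst mps_X (a + Poly_Mapping.single v 1)
      = (mono_subst \<phi> a - mono_subst mps_X a) * \<phi> v + mono_subst mps_X a * (\<phi> v - mps_X v)"
    by (simp add: mono_subst_add algebra_simps)
  also have "\<dots> \<in> mps_ideal V (Suc (mono_deg a) + 1)"
  proof (rule mps_ideal_add)
    show "(mono_subst \<phi> a - mono_subst mps_X a) * \<phi> v \<in> mps_ideal V (Suc (mono_deg a) + 1)"
      by (rule mps_ideal_mult[OF single.IH[OF a] subst_var_ideal[OF v]])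
    show "mono_subst mps_X a * (\<phi> v - mps_X v) \<in> mps_ideal V (Suc (mono_deg a) + 1)"
      using mps_ideal_mult[OF X near[OF v]] by simp
  qed
  finally show ?case by simp
qed simp

abbreviation monos_upto :: "nat \<Rightarrow> ('v \<Rightarrow>\<^sub>0 nat) set" where
  "monos_upto k \<equiv> {a. Poly_Mapping.keys a \<subseteq> V \<and> mono_deg a \<le> k}"

text \<open>The image of a monomial \<open>a\<close> starts in degree \<open>mono_deg a\<close>,
  which bounds the terms of the \<open>Sum_any\<close>. The free bound \<open>k\<close> allows one
  common range of summation for all coefficients of degree up to \<open>k\<close>.\<close>

lemma mps_coeff_subst:
  assumes F: "F \<in> mps_over V" and k: "mono_deg m \<le> k"
  shows "mps_coeff (mps_subst \<phi> F) m =
    (\<Sum>a\<in>monos_upto k. mps_coeff F a * mps_coeff (mono_subst \<phi> a) m)"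
proof -
  let ?f = "\<lambda>a. mps_coeff F a * mps_coeff (mono_subst \<phi> a) m"
  have "a \<in> monos_upto k" if nz: "?f a \<noteq> 0" for a
  proof -
    have a: "Poly_Mapping.keys a \<subseteq> V" using nz F unfolding mps_over_def mem_Collect_eq by (metis mult_zero_left)
    then have "mono_deg a \<le> mono_deg m"
      using mono_subst_ideal[OF a] nz unfolding mps_ideal_iff by (metis mult_zero_right)
    then show ?thesis using a k by simp
  qed
  then have "Sum_any ?f = sum ?f (monos_upto k)"
    by (intro Sum_any.expand_superset finite_monos_le finite_V) auto
  then show ?thesis by (simp add: mps_subst_def mono_subst_def)
qed

lemma subst_over:
  assumes F: "F \<in> mps_over V"
  shows "mps_subst \<phi> F \<in> mps_over V"
  unfolding mps_over_def
proof (intro CollectI allI impI)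
  fix m
  assume "mps_coeff (mps_subst \<phi> F) m \<noteq> 0"
  then obtain a where "a \<in> monos_upto (mono_deg m)" "mps_coeff (mono_subst \<phi> a) m \<noteq> 0"
    unfolding mps_coeff_subst[OF F order_refl]
    by (force elim: sum.not_neutral_contains_not_neutral)
  then show "Poly_Mapping.keys m \<subseteq> V"
    using mono_subst_ideal[of a] unfolding mps_ideal_iff by blast
qed

lemma subst_diff:
  assumes "F \<in> mps_over V" "G \<in> mps_over V"
  shows "mps_subst \<phi> (F - G) = mps_subst \<phi> F - mps_subst \<phi> G"
proof (rule mps_eqI)
  fix m
  have "F - G \<in> mps_over V" using assms mps_ideal_diff[of F V 0 G] by (simp add: mps_ideal_def)
  then show "mps_coeff (mps_subst \<phi> (F - G)) m = mps_coeff (mps_subst \<phi> F - mps_subst \<phi> G) m"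
    using assms by (simp add: mps_coeff_subst[OF _ order_refl] algebra_simps sum_subtractf)
qed

lemma subst_zero [simp]: "mps_subst \<phi> 0 = 0"
  by (rule mps_eqI) (simp add: mps_subst_def)

lemma subst_add:
  assumes "F \<in> mps_over V" "G \<in> mps_over V"
  shows "mps_subst \<phi> (F + G) = mps_subst \<phi> F + mps_subst \<phi> G"
proof (rule mps_eqI)
  fix m
  have "F + G \<in> mps_over V" using assms mps_ideal_add[of F V 0 G] by (simp add: mps_ideal_def)
  then show "mps_coeff (mps_subst \<phi> (F + G)) m = mps_coeff (mps_subst \<phi> F + mps_subst \<phi> G) m"
    using assms by (simp add: mps_coeff_subst[OF _ order_refl] algebra_simps sum.distrib)
qed

lemma subst_sum:
  assumes "\<And>x. x \<in> A \<Longrightarrow> f x \<in> mps_over V"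
  shows "mps_subst \<phi> (sum f A) = (\<Sum>x\<in>A. mps_subst \<phi> (f x))"
  using assms
proof (induction A rule: infinite_finite_induct)
  case (insert x A)
  have "sum f A \<in> mps_over V"
    using insert.prems mps_ideal_sum[of A f V 0] by (simp add: mps_ideal_def)
  then show ?case using insert by (simp add: subst_add)
qed auto

text \<open>Both sides are expanded over pairs of monomials of \<open>F\<close> and
  \<open>G\<close>, using that \<open>mono_subst\<close> turns sums of exponents into
  products.\<close>

lemma subst_mult:
  assumes F: "F \<in> mps_over V" and G: "G \<in> mps_over V"
  shows "mps_subst \<phi> (F * G) = mps_subst \<phi> F * mps_subst \<phi> G"
proof (rule mps_eqI)
  fix m :: "'v \<Rightarrow>\<^sub>0 nat"
  define k where "k = mono_deg m"
  let ?M = "monos_upto k" and ?c = "mps_coeff :: ('v, 'a) mps \<Rightarrow> _"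
  let ?t = "\<lambda>(b, c). ?c F b * ?c G c * ?c (mono_subst \<phi> (b + c)) m"
  have fin: "finite ?M" by (rule finite_monos_le[OF finite_V])
  have FG: "F * G \<in> mps_over V" using F G mps_ideal_mult[of F V 0 G 0] by (simp add: mps_ideal_def)
  have "?c (mps_subst \<phi> (F * G)) m =
      (\<Sum>a\<in>?M. \<Sum>p | fst p + snd p = a. ?c F (fst p) * ?c G (snd p) * ?c (mono_subst \<phi> a) m)"
    using FG by (simp add: mps_coeff_subst[OF _ order_refl] k_def mps_coeff_mult sum_distrib_right case_prod_unfold)
  also have "\<dots> = (\<Sum>(a, p)\<in>(SIGMA a:?M. {p. fst p + snd p = a}).
      ?c F (fst p) * ?c G (snd p) * ?c (mono_subst \<phi> a) m)"
    using finite_add_decompositions fin by (subst sum.Sigma) (auto simp: case_prod_unfold)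
  also have "\<dots> = (\<Sum>p | fst p + snd p \<in> ?M. ?t p)"
    by (rule sum.reindex_bij_witness[where i = "\<lambda>p. (fst p + snd p, p)" and j = snd])
      (auto simp: case_prod_unfold)
  \<comment> \<open>A pair of total degree above \<open>k\<close> contributes nothing at
    \<open>m\<close>, so the triangle of pairs may be filled up to a square, over which the sum
    factors.\<close>
  also have "\<dots> = (\<Sum>p\<in>?M \<times> ?M. ?t p)"
  proof (rule sum.mono_neutral_left)
    show "\<forall>p\<in>?M \<times> ?M - {p. fst p + snd p \<in> ?M}. ?t p = 0"
    proof
      fix p
      assume "p \<in> ?M \<times> ?M - {p. fst p + snd p \<in> ?M}"
      moreover obtain b c where p: "p = (b, c)" by fastforce
      ultimately have bc: "Poly_Mapping.keys (b + c) \<subseteq> V" "\<not> mono_deg (b + c) \<le> mono_deg m"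
        by (auto simp: keys_add_nat k_def)
      then have "?c (mono_subst \<phi> (b + c)) m = 0"
        using mono_subst_ideal[OF bc(1)] unfolding mps_ideal_iff by blast
      then show "?t p = 0" by (simp add: p)
    qed
  qed (use fin in \<open>auto simp: keys_add_nat\<close>)
  also have "\<dots> = (\<Sum>b\<in>?M. \<Sum>c\<in>?M. ?t (b, c))"
    unfolding sum.cartesian_product by (rule sum.cong) auto
  also have "\<dots> = (\<Sum>b\<in>?M. \<Sum>c\<in>?M. \<Sum>p | fst p + snd p = m.
      ?c F b * ?c (mono_subst \<phi> b) (fst p) * (?c G c * ?c (mono_subst \<phi> c) (snd p)))"
    by (simp add: mono_subst_add mps_coeff_mult sum_distrib_left case_prod_unfold mult_ac)
  also have "\<dots> = (\<Sum>p | fst p + snd p = m. \<Sum>b\<in>?M. \<Sum>c\<in>?M.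
      ?c F b * ?c (mono_subst \<phi> b) (fst p) * (?c G c * ?c (mono_subst \<phi> c) (snd p)))"
    by (rule trans[OF sum.cong[OF refl sum.swap] sum.swap])
  also have "\<dots> = (\<Sum>p | fst p + snd p = m. ?c (mps_subst \<phi> F) (fst p) * ?c (mps_subst \<phi> G) (snd p))"
  proof (rule sum.cong)
    fix p
    assume "p \<in> {p. fst p + snd p = m}"
    then have p: "mono_deg (fst p) \<le> k" "mono_deg (snd p) \<le> k" by (auto simp: k_def)
    show "(\<Sum>b\<in>?M. \<Sum>c\<in>?M.
        ?c F b * ?c (mono_subst \<phi> b) (fst p) * (?c G c * ?c (mono_subst \<phi> c) (snd p)))
      = ?c (mps_subst \<phi> F) (fst p) * ?c (mps_subst \<phi> G) (snd p)"
      unfolding mps_coeff_subst[OF F p(1)] mps_coeff_subst[OF G p(2)] sum_product ..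
  qed simp
  also have "\<dots> = ?c (mps_subst \<phi> F * mps_subst \<phi> G) m"
    by (simp add: mps_coeff_mult case_prod_unfold)
  finally show "?c (mps_subst \<phi> (F * G)) m = ?c (mps_subst \<phi> F * mps_subst \<phi> G) m" .
qed

lemma subst_X: "v \<in> V \<Longrightarrow> mps_subst \<phi> (mps_X v) = \<phi> v"
proof (rule mps_eqI)
  fix m
  assume v: "v \<in> V"
  have "mps_coeff (mps_X v) a * mps_coeff (mono_subst \<phi> a) m =
      (mps_coeff (\<phi> v) m when a = Poly_Mapping.single v 1)" for a
    by (auto simp: mps_coeff_X when_def)
  then show "mps_coeff (mps_subst \<phi> (mps_X v)) m = mps_coeff (\<phi> v) m"
    unfolding mps_subst_def mono_subst_def[symmetric] by simp
qed

text \<open>The series \<open>F\<close> is its own substitution of \<open>mps_X\<close>; comparing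
  monomial by monomial, each difference has order above that of its monomial by
  \<open>mono_subst_near\<close>.\<close>

lemma subst_near:
  assumes F: "F \<in> mps_ideal V k"
  shows "mps_subst \<phi> F - F \<in> mps_ideal V (Suc k)"
proof -
  have over: "F \<in> mps_over V" using F by (rule mps_over_ideal)
  have X: "mps_coeff F m = (\<Sum>a\<in>monos_upto (mono_deg m). mps_coeff F a * mps_coeff (mono_subst mps_X a) m)"
    if "Poly_Mapping.keys m \<subseteq> V" for m
  proof -
    have "(\<Sum>a\<in>monos_upto (mono_deg m). mps_coeff F a * mps_coeff (mono_subst mps_X a) m) =
        (\<Sum>a\<in>{m}. mps_coeff F a * mps_coeff (mono_subst mps_X a) m)"
      using that by (intro sum.mono_neutral_right finite_monos_le[OF finite_V])
        (auto simp: mps_coeff_mono_subst_X)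
    then show ?thesis by (simp add: mps_coeff_mono_subst_X)
  qed
  show ?thesis
    unfolding mps_ideal_iff
  proof (intro allI impI)
    fix m
    assume nz: "mps_coeff (mps_subst \<phi> F - F) m \<noteq> 0"
    have m: "Poly_Mapping.keys m \<subseteq> V"
      using nz over subst_over[OF over] unfolding mps_over_def mem_Collect_eq
      by (metis diff_zero mps_coeff_diff)
    have "mps_coeff (mps_subst \<phi> F - F) m = (\<Sum>a\<in>monos_upto (mono_deg m).
        mps_coeff F a * mps_coeff (mono_subst \<phi> a - mono_subst mps_X a) m)"
      by (simp add: mps_coeff_subst[OF over order_refl] X[OF m] algebra_simps sum_subtractf)
    then obtain a where a: "a \<in> monos_upto (mono_deg m)" "mps_coeff F a \<noteq> 0"
      "mps_coeff (mono_subst \<phi> a - mono_subst mps_X a) m \<noteq> 0"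
      using nz by (metis (no_types, lifting) mult_zero_left mult_zero_right
          sum.not_neutral_contains_not_neutral)
    then have "Suc (mono_deg a) \<le> mono_deg m"
      using mono_subst_near[of a] unfolding mps_ideal_iff by blast
    moreover have "k \<le> mono_deg a" using F a(2) unfolding mps_ideal_iff by blast
    ultimately show "Poly_Mapping.keys m \<subseteq> V \<and> Suc k \<le> mono_deg m" using m by simp
  qed
qed

lemma subst_ideal:
  assumes "F \<in> mps_ideal V k"
  shows "mps_subst \<phi> F \<in> mps_ideal V k"
proof -
  have "mps_subst \<phi> F - F \<in> mps_ideal V k"
    by (rule mps_ideal_antimono[OF subst_near[OF assms]]) simp
  from mps_ideal_add[OF this assms] show ?thesis by simp
qed

text \<open>Applied to the components of \<open>L' z'\<close>, this supplies the equations in the cokernel of the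
  Euler operator: each monomial is excluded either in \<open>L' z'\<close> or in its composition with \<open>\<phi>\<close>.\<close>

lemma subst_eq_zero:
  assumes P: "P \<in> mps_over V"
    and split: "\<And>m. mps_coeff P m = 0 \<or> mps_coeff (mps_subst \<phi> P) m = 0"
  shows "P = 0"
proof -
  have "P \<in> mps_ideal V k" for k
  proof (induction k)
    case 0
    then show ?case using P by (simp add: mps_ideal_def)
  next
    case (Suc k)
    have "mps_coeff P m = 0" if "mono_deg m < Suc k" for m
    proof -
      \<comment> \<open>Since \<open>P\<close> has order \<open>k\<close>, it agrees with its
        substitution through degree \<open>k\<close>, so either alternative of \<open>split\<close>
        gives the vanishing.\<close>
      have "mps_coeff (mps_subst \<phi> P - P) m = 0"
        using subst_near[OF Suc] that unfolding mps_ideal_def by blast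
      then show ?thesis using split[of m] by auto
    qed
    then show ?case using P by (simp add: mps_ideal_def)
  qed
  then show ?thesis by (rule mps_ideal_Inter_eq_zero)
qed

text \<open>A preimage of \<open>G\<close> is a fixed point of
  \<open>F \<mapsto> G - (mps_subst \<phi> F - F)\<close>, a contraction because
  \<open>subst_near\<close> gains one order. The index type \<open>unit\<close> specializes the
  fixed point lemma to a single series.\<close>

lemma subst_surj:
  assumes G: "G \<in> mps_ideal V k"
  obtains F where "F \<in> mps_ideal V k" "mps_subst \<phi> F = G"
proof -
  define \<Phi> where "\<Phi> x i = G - (mps_subst \<phi> (x i) - x i)" for x :: "unit \<Rightarrow> ('v, 'a) mps" and i
  obtain x where x: "\<And>i. x i \<in> mps_ideal V k" "\<Phi> x = x"
  proof (rule contraction_fixpoint[of V k \<Phi>])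
    fix x :: "unit \<Rightarrow> ('v, 'a) mps" and i
    assume "\<And>i. x i \<in> mps_ideal V k"
    then show "\<Phi> x i \<in> mps_ideal V k"
      unfolding \<Phi>_def by (intro mps_ideal_diff G subst_ideal)
  next
    fix x y :: "unit \<Rightarrow> ('v, 'a) mps" and j i
    assume xy: "\<And>i. x i \<in> mps_ideal V k" "\<And>i. y i \<in> mps_ideal V k"
      "\<And>i. x i - y i \<in> mps_ideal V j"
    have "\<Phi> x i - \<Phi> y i = - (mps_subst \<phi> (x i - y i) - (x i - y i))"
      using xy(1,2)[THEN mps_over_ideal] by (simp add: \<Phi>_def subst_diff)
    then show "\<Phi> x i - \<Phi> y i \<in> mps_ideal V (Suc j)"
      using mps_ideal_uminus[OF subst_near[OF xy(3)]] by simp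
  qed blast
  from fun_cong[OF x(2), of "()"] have "mps_subst \<phi> (x ()) = G"
    by (simp add: \<Phi>_def algebra_simps)
  then show ?thesis using that x(1) by blast
qed

end

section \<open>Vectors and matrices of series\<close>

definition vec_ideal :: "'v set \<Rightarrow> nat \<Rightarrow> nat \<Rightarrow> ('v, 'a :: zero) mps vec set" where
  "vec_ideal V r k = {x \<in> carrier_vec r. \<forall>i<r. x $ i \<in> mps_ideal V k}"

definition mat_ideal :: "'v set \<Rightarrow> nat \<Rightarrow> nat \<Rightarrow> nat \<Rightarrow> ('v, 'a :: zero) mps mat set" where
  "mat_ideal V r c k = {A \<in> carrier_mat r c. \<forall>i<r. \<forall>j<c. A $$ (i, j) \<in> mps_ideal V k}"

lemma vec_idealD: "x \<in> vec_ideal V r k \<Longrightarrow> i < r \<Longrightarrow> x $ i \<in> mps_ideal V k"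
  by (simp add: vec_ideal_def)

lemma vec_ideal_carrier: "x \<in> vec_ideal V r k \<Longrightarrow> x \<in> carrier_vec r"
  by (simp add: vec_ideal_def)

lemma mat_idealD: "A \<in> mat_ideal V r c k \<Longrightarrow> i < r \<Longrightarrow> j < c \<Longrightarrow> A $$ (i, j) \<in> mps_ideal V k"
  by (simp add: mat_ideal_def)

lemma mat_ideal_carrier: "A \<in> mat_ideal V r c k \<Longrightarrow> A \<in> carrier_mat r c"
  by (simp add: mat_ideal_def)

lemma vec_ideal_antimono: "x \<in> vec_ideal V r k \<Longrightarrow> j \<le> k \<Longrightarrow> x \<in> vec_ideal V r j"
  unfolding vec_ideal_def by (auto intro: mps_ideal_antimono)

lemma mat_ideal_antimono: "A \<in> mat_ideal V r c k \<Longrightarrow> j \<le> k \<Longrightarrow> A \<in> mat_ideal V r c j"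
  unfolding mat_ideal_def by (auto intro: mps_ideal_antimono)

lemma vec_ideal_add: "x \<in> vec_ideal V r k \<Longrightarrow> y \<in> vec_ideal V r k \<Longrightarrow> x + y \<in> vec_ideal V r k"
  unfolding vec_ideal_def by (auto intro!: mps_ideal_add)

lemma vec_ideal_diff: "x \<in> vec_ideal V r k \<Longrightarrow> y \<in> vec_ideal V r k \<Longrightarrow> x - y \<in> vec_ideal V r k"
  unfolding vec_ideal_def by (auto intro!: mps_ideal_diff)

lemma mat_ideal_add:
  "A \<in> mat_ideal V r c k \<Longrightarrow> B \<in> mat_ideal V r c k \<Longrightarrow> A + B \<in> mat_ideal V r c k"
  unfolding mat_ideal_def by (auto intro!: mps_ideal_add)

lemma mat_ideal_diff:
  "A \<in> mat_ideal V r c k \<Longrightarrow> B \<in> mat_ideal V r c k \<Longrightarrow> A - B \<in> mat_ideal V r c k"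
  unfolding mat_ideal_def by (auto intro!: mps_ideal_diff minus_carrier_mat)

lemma mat_ideal_mult:
  "A \<in> mat_ideal V r l j \<Longrightarrow> B \<in> mat_ideal V l c k \<Longrightarrow> A * B \<in> mat_ideal V r c (j + k)"
  unfolding mat_ideal_def by (auto simp: scalar_prod_def intro!: mps_ideal_sum mps_ideal_mult)

lemma mat_ideal_mult_vec:
  "A \<in> mat_ideal V r l j \<Longrightarrow> x \<in> vec_ideal V l k \<Longrightarrow> A *\<^sub>v x \<in> vec_ideal V r (j + k)"
  unfolding mat_ideal_def vec_ideal_def
  by (auto simp: scalar_prod_def intro!: mps_ideal_sum mps_ideal_mult)

lemma vec_ideal_eqI:
  assumes "x \<in> carrier_vec r" "y \<in> carrier_vec r" "\<And>k. x - y \<in> vec_ideal V r k"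
  shows "x = y"
proof (rule eq_vecI)
  fix i
  assume "i < dim_vec y"
  then have "x $ i - y $ i = 0"
    using assms by (intro mps_ideal_Inter_eq_zero[of _ V]) (auto simp: vec_ideal_def)
  then show "x $ i = y $ i" by simp
qed (use assms in auto)

lemma mat_ideal_eqI:
  assumes "A \<in> carrier_mat r c" "B \<in> carrier_mat r c" "\<And>k. A - B \<in> mat_ideal V r c k"
  shows "A = B"
proof (rule eq_matI)
  fix i j
  assume "i < dim_row B" "j < dim_col B"
  then have "A $$ (i, j) - B $$ (i, j) = 0"
    using assms by (intro mps_ideal_Inter_eq_zero[of _ V]) (auto simp: mat_ideal_def)
  then show "A $$ (i, j) = B $$ (i, j)" by simp
qed (use assms in auto)

section \<open>Contractions on vectors, and right division by \<open>1 + M\<close>\<close>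

text \<open>Existence comes from \<open>contraction_fixpoint\<close>; the difference of two fixed
  points gains an order at each application of \<open>\<Phi>\<close>, hence vanishes.\<close>

lemma vec_contraction_unique_fixpoint:
  fixes \<Phi> :: "('v, 'a :: comm_ring_1) mps vec \<Rightarrow> ('v, 'a) mps vec"
  assumes closed: "\<And>x. x \<in> vec_ideal V r k \<Longrightarrow> \<Phi> x \<in> vec_ideal V r k"
    and contr: "\<And>x y j. x \<in> vec_ideal V r k \<Longrightarrow> y \<in> vec_ideal V r k \<Longrightarrow>
      x - y \<in> vec_ideal V r j \<Longrightarrow> \<Phi> x - \<Phi> y \<in> vec_ideal V r (Suc j)"
  shows "\<exists>!x. x \<in> vec_ideal V r k \<and> \<Phi> x = x"
proof (rule ex_ex1I)
  \<comment> \<open>Components beyond the dimension are set to \<open>0\<close>, which turns vectors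
    into families indexed by all naturals.\<close>
  define \<Psi> where "\<Psi> x i = (if i < r then \<Phi> (vec r x) $ i else 0)"
    for x :: "nat \<Rightarrow> ('v, 'a) mps" and i
  have vec: "vec r x \<in> vec_ideal V r k" if "\<And>i. x i \<in> mps_ideal V k" for x k
    using that by (auto simp: vec_ideal_def)
  have closed': "\<Psi> x i \<in> mps_ideal V k" if "\<And>i. x i \<in> mps_ideal V k" for x i
    using vec_idealD[OF closed[OF vec[OF that]]] by (simp add: \<Psi>_def)
  have contr': "\<Psi> x i - \<Psi> y i \<in> mps_ideal V (Suc j)"
    if x: "\<And>i. x i \<in> mps_ideal V k" and y: "\<And>i. y i \<in> mps_ideal V k"
      and xy: "\<And>i. x i - y i \<in> mps_ideal V j" for x y j i
  proof (cases "i < r")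
    case True
    have "vec r x - vec r y = vec r (\<lambda>i. x i - y i)" by auto
    then have "vec r x - vec r y \<in> vec_ideal V r j" using vec[OF xy] by simp
    from vec_idealD[OF contr[OF vec[OF x] vec[OF y] this] True]
    have "(\<Phi> (vec r x) - \<Phi> (vec r y)) $ i \<in> mps_ideal V (Suc j)" .
    moreover have "dim_vec (\<Phi> (vec r y)) = r"
      using vec_ideal_carrier[OF closed[OF vec[OF y]]] by (rule carrier_vecD)
    ultimately show ?thesis using True by (simp add: \<Psi>_def)
  next
    case False
    then show ?thesis by (simp add: \<Psi>_def)
  qed
  obtain x where x: "\<And>i. x i \<in> mps_ideal V k" "\<Psi> x = x"
    using contraction_fixpoint[of V k \<Psi>, OF closed' contr'] by blast
  have "\<Phi> (vec r x) = vec r x"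
  proof (rule eq_vecI)
    show "\<Phi> (vec r x) $ i = vec r x $ i" if "i < dim_vec (vec r x)" for i
      using that fun_cong[OF x(2), of i] by (simp add: \<Psi>_def)
    show "dim_vec (\<Phi> (vec r x)) = dim_vec (vec r x)"
      using closed[OF vec[OF x(1)]] by (auto simp: vec_ideal_def)
  qed
  with vec[OF x(1)] show "\<exists>x. x \<in> vec_ideal V r k \<and> \<Phi> x = x" by (intro exI conjI)
next
  fix x y
  assume x: "x \<in> vec_ideal V r k \<and> \<Phi> x = x" and y: "y \<in> vec_ideal V r k \<and> \<Phi> y = y"
  have "x - y \<in> vec_ideal V r j" for j
  proof (induction j)
    case 0
    have "x - y \<in> vec_ideal V r k" using x y by (simp add: vec_ideal_diff)
    then show ?case by (rule vec_ideal_antimono) simp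
  next
    case (Suc j)
    then show ?case using contr[of x y j] x y by simp
  qed
  with x y show "x = y" by (intro vec_ideal_eqI[of x r y V]) (auto intro: vec_ideal_carrier)
qed

text \<open>For \<open>M\<close> of positive order, \<open>X \<mapsto> A - X * M\<close> is a
  contraction; iterating it gives the Neumann series for \<open>A\<close> times the inverse of
  \<open>1 + M\<close>.\<close>

lemma mat_right_div_exists:
  fixes M :: "('v, 'a :: comm_ring_1) mps mat"
  assumes M: "M \<in> mat_ideal V n n 1" and A: "A \<in> mat_ideal V r n k"
  obtains X where "X \<in> mat_ideal V r n k" "X * (1\<^sub>m n + M) = A"
proof -
  define \<Psi> where "\<Psi> x p = (case p of (i, j) \<Rightarrow>
      if i < r \<and> j < n then (A - mat r n x * M) $$ (i, j) else 0)"
    for x :: "nat \<times> nat \<Rightarrow> ('v, 'a) mps" and p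
  have mat: "mat r n x \<in> mat_ideal V r n k" if "\<And>i. x i \<in> mps_ideal V k" for x k
    using that by (auto simp: mat_ideal_def)
  have M': "M \<in> carrier_mat n n" and A': "A \<in> carrier_mat r n"
    using M A by (auto simp: mat_ideal_def)
  have mult_M: "X * M \<in> mat_ideal V r n (Suc j)" if "X \<in> mat_ideal V r n j" for X j
    using mat_ideal_mult[OF that M] by simp
  have closed: "\<Psi> x p \<in> mps_ideal V k" if "\<And>i. x i \<in> mps_ideal V k" for x p
  proof -
    have "A - mat r n x * M \<in> mat_ideal V r n k"
      by (rule mat_ideal_diff[OF A mat_ideal_antimono[OF mult_M[OF mat[OF that]]]]) simp
    then show ?thesis unfolding \<Psi>_def mat_ideal_def by (auto split: prod.split)
  qed
  have contr: "\<Psi> x p - \<Psi> y p \<in> mps_ideal V (Suc l)"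
    if xy: "\<And>i. x i - y i \<in> mps_ideal V l" for x y l p
  proof -
    obtain i j where p: "p = (i, j)" by fastforce
    have "mat r n (\<lambda>p. y p - x p) = mat r n y - mat r n x" by auto
    moreover have "mat r n (\<lambda>p. y p - x p) * M \<in> mat_ideal V r n (Suc l)"
      using mps_ideal_uminus[OF xy] by (intro mult_M mat) simp
    ultimately have *: "mat r n y * M - mat r n x * M \<in> mat_ideal V r n (Suc l)"
      using M' by (simp add: minus_mult_distrib_mat[of _ r n _ _ n])
    show ?thesis
    proof (cases "i < r \<and> j < n")
      case True
      then have "\<Psi> x p - \<Psi> y p = (mat r n y * M - mat r n x * M) $$ (i, j)"
        using M' A' by (simp add: \<Psi>_def p)
      then show ?thesis using mat_idealD[OF *] True by simp
    next
      case False
      then show ?thesis by (auto simp: \<Psi>_def p)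
    qed
  qed
  obtain x where x: "\<And>i. x i \<in> mps_ideal V k" "\<Psi> x = x"
    using contraction_fixpoint[of V k \<Psi>, OF closed contr] by blast
  let ?X = "mat r n x"
  have "?X = A - ?X * M"
  proof (rule eq_matI)
    show "?X $$ (i, j) = (A - ?X * M) $$ (i, j)"
      if "i < dim_row (A - ?X * M)" "j < dim_col (A - ?X * M)" for i j
      using that M' A' fun_cong[OF x(2), of "(i, j)"] by (simp add: \<Psi>_def)
  qed (use M' A' in auto)
  then have "?X + ?X * M = A - ?X * M + ?X * M" by simp
  also have "\<dots> = A" using M' A' by (intro eq_matI) auto
  finally have "?X * (1\<^sub>m n + M) = A"
    using M' by (simp add: mult_add_distrib_mat[of _ r n _ n])
  with mat[OF x(1)] show ?thesis by (rule that)
qed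

text \<open>In \<open>X = X * (1 + M) - X * M\<close> the last term has higher order than
  \<open>X\<close>, so the order of \<open>X\<close> climbs one by one until it reaches
  \<open>k\<close>.\<close>

lemma mat_right_div_ideal:
  fixes M :: "('v, 'a :: comm_ring_1) mps mat"
  assumes M: "M \<in> mat_ideal V n n 1" and X: "X \<in> mat_ideal V r n i"
    and A: "X * (1\<^sub>m n + M) \<in> mat_ideal V r n k"
  shows "X \<in> mat_ideal V r n k"
proof -
  have M': "M \<in> carrier_mat n n" and X': "X \<in> carrier_mat r n"
    using M X by (auto simp: mat_ideal_def)
  have eq: "X * (1\<^sub>m n + M) - X * M = X"
    unfolding mult_add_distrib_mat[OF X' one_carrier_mat M'] using X' M' by (intro eq_matI) auto
  have step: "X \<in> mat_ideal V r n (Suc j)" if "X \<in> mat_ideal V r n j" "Suc j \<le> k" for j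
  proof -
    have "X * M \<in> mat_ideal V r n (Suc j)" using mat_ideal_mult[OF that(1) M] by simp
    from mat_ideal_diff[OF mat_ideal_antimono[OF A that(2)] this] show ?thesis unfolding eq .
  qed
  have "j \<le> k \<Longrightarrow> X \<in> mat_ideal V r n j" for j
  proof (induction j)
    case 0
    show ?case by (rule mat_ideal_antimono[OF X]) simp
  qed (simp add: step)
  then show ?thesis by simp
qed

text \<open>The product of \<open>X - Y\<close> with \<open>1 + M\<close> is zero and so has every
  order, and division does not lower the order.\<close>

lemma mat_right_cancel:
  fixes M :: "('v, 'a :: comm_ring_1) mps mat"
  assumes M: "M \<in> mat_ideal V n n 1" and X: "X \<in> mat_ideal V r n i" and Y: "Y \<in> mat_ideal V r n i"
    and eq: "X * (1\<^sub>m n + M) = Y * (1\<^sub>m n + M)"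
  shows "X = Y"
proof (rule mat_ideal_eqI)
  note carriers = M[THEN mat_ideal_carrier] X[THEN mat_ideal_carrier] Y[THEN mat_ideal_carrier]
  show "X \<in> carrier_mat r n" "Y \<in> carrier_mat r n" using carriers by auto
  fix k
  have "(X - Y) * (1\<^sub>m n + M) = 0\<^sub>m r n"
    using carriers eq by (simp add: minus_mult_distrib_mat[of _ r n _ _ n])
  also have "\<dots> \<in> mat_ideal V r n k" by (auto simp: mat_ideal_def)
  finally show "X - Y \<in> mat_ideal V r n k"
    using mat_right_div_ideal[OF M mat_ideal_diff[OF X Y]] by blast
qed


section \<open>Conjugation\<close>

abbreviation conj_mono :: "(coord \<Rightarrow>\<^sub>0 nat) \<Rightarrow> (coord \<Rightarrow>\<^sub>0 nat)" where
  "conj_mono \<equiv> Poly_Mapping.map_key conj_coord"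

lemma conj_mono_conj_mono [simp]: "conj_mono (conj_mono m) = m"
  by (rule poly_mapping_eqI) simp

lemma conj_mono_add: "conj_mono (a + b) = conj_mono a + conj_mono b"
  by (rule poly_mapping_eqI) (simp add: lookup_add)

lemma conj_mono_zero [simp]: "conj_mono 0 = 0"
  by (rule poly_mapping_eqI) simp

lemma conj_mono_eq_0_iff [simp]: "conj_mono m = 0 \<longleftrightarrow> m = 0"
  by (metis conj_mono_conj_mono conj_mono_zero)

lemma conj_mono_single: "conj_mono (Poly_Mapping.single v k) = Poly_Mapping.single (conj_coord v) k"
  by (rule poly_mapping_eqI) (auto simp: lookup_single when_def)

lemma keys_conj_mono: "Poly_Mapping.keys (conj_mono m) = conj_coord ` Poly_Mapping.keys m"
proof (rule Set.set_eqI)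
  fix v
  have "v \<in> conj_coord ` Poly_Mapping.keys m \<longleftrightarrow> conj_coord v \<in> Poly_Mapping.keys m"
    by (metis conj_coord_conj_coord image_iff)
  then show "v \<in> Poly_Mapping.keys (conj_mono m) \<longleftrightarrow> v \<in> conj_coord ` Poly_Mapping.keys m"
    by (simp add: in_keys_iff)
qed

lemma mono_deg_conj_mono [simp]: "mono_deg (conj_mono m) = mono_deg m"
  unfolding mono_deg_def keys_conj_mono by (subst sum.reindex) (auto intro: inj_on_subset[OF inj_conj_coord])

lemma conj_coord_in_coords [simp]: "conj_coord v \<in> coords n d \<longleftrightarrow> v \<in> coords n d"
  by (cases v) (auto simp: coords_def)

lemma finite_coords: "finite (coords n d)"
  by (simp add: coords_def)

lemma keys_conj_mono_coords [simp]:
  "Poly_Mapping.keys (conj_mono m) \<subseteq> coords n d \<longleftrightarrow> Poly_Mapping.keys m \<subseteq> coords n d"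
  by (auto simp: keys_conj_mono)

lemma mps_coeff_series_cnj [simp]:
  "mps_coeff (series_cnj F) m = cnj (mps_coeff F (conj_mono m))"
  by (simp add: series_cnj_def)

lemma series_cnj_series_cnj [simp]: "series_cnj (series_cnj F) = F"
  by (rule mps_eqI) simp

lemma series_cnj_diff: "series_cnj (F - G) = series_cnj F - series_cnj G"
  by (rule mps_eqI) simp

lemma series_cnj_add: "series_cnj (F + G) = series_cnj F + series_cnj G"
  by (rule mps_eqI) simp

lemma series_cnj_one [simp]: "series_cnj 1 = 1"
  by (rule mps_eqI) (simp add: mps_coeff_one)

lemma series_cnj_X [simp]: "series_cnj (mps_X v) = mps_X (conj_coord v)"
proof (rule mps_eqI)
  fix m
  have "conj_mono m = Poly_Mapping.single v 1 \<longleftrightarrow> m = Poly_Mapping.single (conj_coord v) 1"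
    by (metis conj_mono_conj_mono conj_mono_single)
  then show "mps_coeff (series_cnj (mps_X v)) m = mps_coeff (mps_X (conj_coord v)) m"
    by (simp add: mps_coeff_X)
qed

lemma series_cnj_mult: "series_cnj (F * G) = series_cnj F * series_cnj G"
proof (rule mps_eqI)
  fix m
  show "mps_coeff (series_cnj (F * G)) m = mps_coeff (series_cnj F * series_cnj G) m"
    unfolding mps_coeff_mult mps_coeff_series_cnj cnj_sum
    by (rule sum.reindex_bij_witness[where i = "map_prod conj_mono conj_mono"
          and j = "map_prod conj_mono conj_mono"])
      (auto simp: conj_mono_add[symmetric])
qed

lemma series_cnj_ideal [simp]:
  "series_cnj F \<in> mps_ideal (coords n d) k \<longleftrightarrow> F \<in> mps_ideal (coords n d) k"
proof -
  have *: "series_cnj F \<in> mps_ideal (coords n d) k" if "F \<in> mps_ideal (coords n d) k" for F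
    using that unfolding mps_ideal_iff
    by (metis complex_cnj_zero keys_conj_mono_coords mono_deg_conj_mono mps_coeff_series_cnj)
  show ?thesis using *[of F] *[of "series_cnj F"] by auto
qed

lemma mps_coeff_series_Re:
  "mps_coeff (series_Re F) m = (mps_coeff F m + cnj (mps_coeff F (conj_mono m))) / 2"
  by (simp add: series_Re_def)

lemma real_valued_series_Re: "real_valued (series_Re F)"
  unfolding real_valued_def by (rule mps_eqI) (simp add: mps_coeff_series_Re add.commute)

lemma series_Re_ideal:
  assumes "F \<in> mps_ideal (coords n d) k"
  shows "series_Re F \<in> mps_ideal (coords n d) k"
proof -
  have "F + series_cnj F \<in> mps_ideal (coords n d) k" using assms by (intro mps_ideal_add) auto
  then show ?thesis unfolding mps_ideal_iff by (auto simp: mps_coeff_series_Re)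
qed

lemma series_Re_diff: "series_Re (F - G) = series_Re F - series_Re G"
  by (rule mps_eqI) (simp add: mps_coeff_series_Re field_simps)

section \<open>The Euler operator and the degrees in \<open>z\<close> and
  \<open>zbar\<close>\<close>

lemma euler_vec_mult:
  assumes "A \<in> carrier_mat r n" "i < r"
  shows "euler_eval n A $ i = (\<Sum>j<n. A $$ (i, j) * mps_X (ZVar j))"
  using assms by (auto simp: euler_eval_def scalar_prod_def atLeast0LessThan intro!: sum.cong)

text \<open>The eigenvalue of the monomial \<open>m\<close> under the Euler operator in
  \<open>z\<close>; \<open>zbar_deg\<close> is its conjugate.\<close>

definition z_deg :: "nat \<Rightarrow> (coord \<Rightarrow>\<^sub>0 nat) \<Rightarrow> nat" where
  "z_deg n m = (\<Sum>j<n. Poly_Mapping.lookup m (ZVar j))"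

definition zbar_deg :: "nat \<Rightarrow> (coord \<Rightarrow>\<^sub>0 nat) \<Rightarrow> nat" where
  "zbar_deg n m = (\<Sum>j<n. Poly_Mapping.lookup m (ZbarVar j))"

lemma z_deg_conj_mono [simp]: "z_deg n (conj_mono m) = zbar_deg n m"
  by (simp add: z_deg_def zbar_deg_def)

lemma zbar_deg_conj_mono [simp]: "zbar_deg n (conj_mono m) = z_deg n m"
  by (simp add: z_deg_def zbar_deg_def)

lemma mps_coeff_pderiv_mult_X:
  "mps_coeff (mps_pderiv v F * mps_X v) m = of_nat (Poly_Mapping.lookup m v) * mps_coeff F m"
proof (cases "Poly_Mapping.lookup m v = 0")
  case False
  then have "m = m - Poly_Mapping.single v 1 + Poly_Mapping.single v 1"
    by (intro mono_decompose) (simp add: in_keys_iff)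
  moreover from arg_cong[OF this, of "\<lambda>m. Poly_Mapping.lookup m v"]
  have "Poly_Mapping.lookup (m - Poly_Mapping.single v 1) v + 1 = Poly_Mapping.lookup m v"
    by (simp add: lookup_add)
  ultimately show ?thesis using False by (simp add: mps_coeff_mult_X mps_pderiv_def del: of_nat_Suc)
qed (simp add: mps_coeff_mult_X)

lemma jac_carrier: "h \<in> carrier_vec r \<Longrightarrow> jac x c h \<in> carrier_mat r c"
  by (auto simp: jac_def)

lemma jac_ideal: "h \<in> vec_ideal V r (Suc k) \<Longrightarrow> jac x c h \<in> mat_ideal V r c k"
  unfolding vec_ideal_def mat_ideal_def jac_def by (auto intro!: mps_ideal_pderiv)

lemma jac_diff:
  assumes "h \<in> carrier_vec r" "h' \<in> carrier_vec r"
  shows "jac x c (h - h') = jac x c h - jac x c h'"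
  using assms by (intro eq_matI) (auto simp: jac_def mps_pderiv_diff)

text \<open>Each \<open>mps_X v\<close> times the derivative in \<open>v\<close> multiplies a
  monomial by its exponent, and these exponents add up over the \<open>z\<close> variables.\<close>

lemma mps_coeff_euler_jac:
  assumes "h \<in> carrier_vec r" "i < r"
  shows "mps_coeff (euler_eval n (jac ZVar n h) $ i) m = of_nat (z_deg n m) * mps_coeff (h $ i) m"
proof -
  have "euler_eval n (jac ZVar n h) $ i = (\<Sum>j<n. mps_pderiv (ZVar j) (h $ i) * mps_X (ZVar j))"
    unfolding euler_vec_mult[OF jac_carrier[OF assms(1)] assms(2)]
    using assms by (auto simp: jac_def)
  then show ?thesis
    by (simp add: mps_coeff_pderiv_mult_X z_deg_def sum_distrib_right)
qed

text \<open>Every component is a combination of the \<open>z\<close> variables, so it vanishes at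
  \<open>z = 0\<close>. This is what makes the equations in the cokernel automatic.\<close>

lemma mps_coeff_euler_eval_eq_0:
  assumes "A \<in> carrier_mat r n" "i < r" "z_deg n m = 0"
  shows "mps_coeff (euler_eval n A $ i) m = 0"
  using assms(3) unfolding euler_vec_mult[OF assms(1,2)] by (simp add: mps_coeff_mult_X z_deg_def)

lemma euler_eval_ideal:
  assumes "A \<in> mat_ideal (coords n d) r n k"
  shows "euler_eval n A \<in> vec_ideal (coords n d) r (Suc k)"
proof -
  have "vec n (\<lambda>j. mps_X (ZVar j)) \<in> vec_ideal (coords n d) n 1"
    by (auto simp: vec_ideal_def coords_def intro: mps_ideal_X[unfolded One_nat_def])
  from mat_ideal_mult_vec[OF assms this] show ?thesis by (simp add: euler_eval_def)
qed

lemma euler_eval_carrier: "A \<in> carrier_mat r n \<Longrightarrow> euler_eval n A \<in> carrier_vec r"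
  by (auto simp: euler_eval_def)

lemma euler_eval_diff:
  assumes "A \<in> carrier_mat r n" "B \<in> carrier_mat r n"
  shows "euler_eval n (A - B) = euler_eval n A - euler_eval n B"
  using assms by (simp add: euler_eval_def minus_mult_distrib_mat_vec[of _ r n])

lemma euler_eval_add:
  assumes "A \<in> carrier_mat r n" "B \<in> carrier_mat r n"
  shows "euler_eval n (A + B) = euler_eval n A + euler_eval n B"
  using assms by (simp add: euler_eval_def add_mult_distrib_mat_vec[of _ r n])

lemma map_vec_cnj_ideal:
  "f \<in> vec_ideal (coords n d) r k \<Longrightarrow> map_vec series_cnj f \<in> vec_ideal (coords n d) r k"
  by (auto simp: vec_ideal_def)

section \<open>The transformed structure\<close>

locale almost_CR =
  fixes n d :: nat and Lzb Lw :: "series mat"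
  assumes Lzb: "Lzb \<in> mat_ideal (coords n d) n n 1"
    and Lw: "Lw \<in> mat_ideal (coords n d) d n 1"
begin

abbreviation V :: "coord set" where "V \<equiv> coords n d"

abbreviation Z :: "series vec" where "Z \<equiv> vec n (\<lambda>j. mps_X (ZVar j))"

text \<open>The derivatives of \<open>h\<close> along the lifts \<open>\<partial>/\<partial>z\<^sub>j + L(\<partial>/\<partial>z\<^sub>j)\<close>, as columns.\<close>

definition D :: "series vec \<Rightarrow> series mat" where
  "D h = jac ZVar n h + jac ZbarVar n h * Lzb + jac UVar d h * Lw"

lemma Lzb_carrier: "Lzb \<in> carrier_mat n n" and Lw_carrier: "Lw \<in> carrier_mat d n"
  using Lzb Lw by (auto simp: mat_ideal_def)

lemma Z_ideal: "Z \<in> vec_ideal V n 1"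
  by (auto simp: vec_ideal_def coords_def intro: mps_ideal_X[unfolded One_nat_def])

lemma D_carrier: "h \<in> carrier_vec r \<Longrightarrow> D h \<in> carrier_mat r n"
  unfolding D_def
  by (intro add_carrier_mat mult_carrier_mat[OF jac_carrier Lw_carrier])

lemma D_ideal:
  assumes "h \<in> vec_ideal V r (Suc k)"
  shows "D h \<in> mat_ideal V r n k"
  unfolding D_def
  by (intro mat_ideal_add jac_ideal[OF assms]
      mat_ideal_antimono[OF mat_ideal_mult[OF jac_ideal[OF assms] Lzb]]
      mat_ideal_antimono[OF mat_ideal_mult[OF jac_ideal[OF assms] Lw]]) simp_all

lemma D_diff:
  assumes "h \<in> carrier_vec r" "h' \<in> carrier_vec r"
  shows "D (h - h') = D h - D h'"
proof -
  note c = jac_carrier[OF assms(1)] jac_carrier[OF assms(2)]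
  have regroup: "(a - a') + (b - b') + (e - e') = (a + b + e) - (a' + b' + e')"
    if "a \<in> carrier_mat r n" "a' \<in> carrier_mat r n" "b \<in> carrier_mat r n" "b' \<in> carrier_mat r n"
      "e \<in> carrier_mat r n" "e' \<in> carrier_mat r n" for a a' b b' e e' :: "series mat"
    using that by (intro eq_matI) auto
  show ?thesis
    unfolding D_def jac_diff[OF assms]
    unfolding minus_mult_distrib_mat[OF c Lzb_carrier] minus_mult_distrib_mat[OF c Lw_carrier]
    by (intro regroup mult_carrier_mat[OF _ Lzb_carrier] mult_carrier_mat[OF _ Lw_carrier] c)
qed

text \<open>Since \<open>L\<close> has no constant term, the terms of \<open>D h\<close> containing
  \<open>L\<close> have one order more than the Jacobian in \<open>z\<close>. Along the Euler field,
  \<open>D\<close> is thus the constant-coefficient Euler operator up to higher order.\<close>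

lemma euler_D:
  assumes "h \<in> vec_ideal V r (Suc k)"
  shows "euler_eval n (D h) - euler_eval n (jac ZVar n h) \<in> vec_ideal V r (Suc (Suc k))"
proof -
  let ?A = "jac ZbarVar n h * Lzb + jac UVar d h * Lw"
  have A: "?A \<in> mat_ideal V r n (Suc k)"
    using mat_ideal_mult[OF jac_ideal[OF assms] Lzb] mat_ideal_mult[OF jac_ideal[OF assms] Lw]
    by (intro mat_ideal_add) auto
  have h: "h \<in> carrier_vec r" using assms by (rule vec_ideal_carrier)
  note c = jac_carrier[OF h] D_carrier[OF h]
  have regroup: "(a + b + e) - a = b + e"
    if "a \<in> carrier_mat r n" "b \<in> carrier_mat r n" "e \<in> carrier_mat r n" for a b e :: "series mat"
    using that by (intro eq_matI) auto
  have "D h - jac ZVar n h = ?A"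
    unfolding D_def
    by (intro regroup mult_carrier_mat[OF _ Lzb_carrier] mult_carrier_mat[OF _ Lw_carrier] c)
  then have "euler_eval n (D h) - euler_eval n (jac ZVar n h) = euler_eval n ?A"
    using euler_eval_diff[OF c(2) jac_carrier[OF h, of ZVar n]] by simp
  then show ?thesis using euler_eval_ideal[OF A] by simp
qed

text \<open>For \<open>h = g\<close>, \<open>L0 = Lw\<close> and for \<open>h = fbar\<close>, \<open>L0 = Lzb\<close>, the matrix \<open>K L0 f h\<close> is
  the block of \<open>L'\<close> at the point \<open>(z, zbar, u) + (f, fbar, g)\<close>.\<close>

definition K :: "series mat \<Rightarrow> series vec \<Rightarrow> series vec \<Rightarrow> series mat" where
  "K L0 f h = (SOME X. X \<in> mat_ideal V (dim_vec h) n 1 \<and> X * (1\<^sub>m n + D f) = D h + L0)"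

text \<open>As \<open>D f\<close> has positive order, right division by \<open>1 + D f\<close> is
  possible, so the choice in \<open>K\<close> has a witness; by \<open>mat_right_cancel\<close> it
  is the only one.\<close>

lemma K:
  assumes f: "f \<in> vec_ideal V n 2" and h: "h \<in> vec_ideal V r 2" and L0: "L0 \<in> mat_ideal V r n 1"
  shows "K L0 f h \<in> mat_ideal V r n 1" "K L0 f h * (1\<^sub>m n + D f) = D h + L0"
proof -
  have "D f \<in> mat_ideal V n n 1" "D h \<in> mat_ideal V r n 1"
    using f h by (auto simp: numeral_2_eq_2 intro: D_ideal)
  then obtain X where "X \<in> mat_ideal V r n 1" "X * (1\<^sub>m n + D f) = D h + L0"
    by (rule mat_right_div_exists[OF _ mat_ideal_add[OF _ L0]])
  moreover have "dim_vec h = r" using h by (auto simp: vec_ideal_def)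
  ultimately have "K L0 f h \<in> mat_ideal V r n 1 \<and> K L0 f h * (1\<^sub>m n + D f) = D h + L0"
    unfolding K_def by (metis (mono_tags, lifting) someI)
  then show "K L0 f h \<in> mat_ideal V r n 1" "K L0 f h * (1\<^sub>m n + D f) = D h + L0" by auto
qed

text \<open>The value of \<open>L' z'\<close> at the image point, minus its linear part with
  constant coefficients, which is the Euler operator applied to \<open>h\<close>.\<close>

definition remainder :: "series mat \<Rightarrow> series vec \<Rightarrow> series vec \<Rightarrow> series vec" where
  "remainder L0 f h = K L0 f h *\<^sub>v (Z + f) - euler_eval n (jac ZVar n h)"

lemma remainder_ideal:
  assumes f: "f \<in> vec_ideal V n 2" and h: "h \<in> vec_ideal V r 2" and L0: "L0 \<in> mat_ideal V r n 1"
  shows "remainder L0 f h \<in> vec_ideal V r 2"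
proof -
  have "Z + f \<in> vec_ideal V n 1"
    by (rule vec_ideal_add[OF Z_ideal vec_ideal_antimono[OF f]]) simp
  from mat_ideal_mult_vec[OF K(1)[OF assms] this]
  have "K L0 f h *\<^sub>v (Z + f) \<in> vec_ideal V r 2" by (simp add: numeral_2_eq_2)
  moreover have "jac ZVar n h \<in> mat_ideal V r n 1"
    using h by (auto simp: numeral_2_eq_2 intro: jac_ideal)
  then have "euler_eval n (jac ZVar n h) \<in> vec_ideal V r 2"
    using euler_eval_ideal[of _ n d r 1] by (simp add: numeral_2_eq_2)
  ultimately show ?thesis unfolding remainder_def by (rule vec_ideal_diff)
qed

text \<open>Substituting \<open>K = D h + L0 - K * D f\<close> isolates a term independent of
  \<open>f\<close> and \<open>h\<close>; each of the others depends on them with a gain of one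
  order.\<close>

lemma remainder_eq:
  assumes f: "f \<in> vec_ideal V n 2" and h: "h \<in> vec_ideal V r 2" and L0: "L0 \<in> mat_ideal V r n 1"
  shows "remainder L0 f h = euler_eval n (D h) - euler_eval n (jac ZVar n h) + euler_eval n L0
    - euler_eval n (K L0 f h * D f) + K L0 f h *\<^sub>v f"
proof -
  have fc: "f \<in> carrier_vec n" and hc: "h \<in> carrier_vec r" and L0c: "L0 \<in> carrier_mat r n"
    using f h L0 by (auto intro: vec_ideal_carrier mat_ideal_carrier)
  note Kc = K(1)[OF assms, THEN mat_ideal_carrier]
  note Dc = D_carrier[OF fc] D_carrier[OF hc]
  note jc = jac_carrier[OF hc, of ZVar n]
  have "K L0 f h + K L0 f h * D f = D h + L0"
    using K(2)[OF assms] unfolding mult_add_distrib_mat[OF Kc one_carrier_mat Dc(1)]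
    using Kc by simp
  then have "euler_eval n (K L0 f h) + euler_eval n (K L0 f h * D f)
      = euler_eval n (D h) + euler_eval n L0"
    using Kc Dc L0c by (simp add: euler_eval_add[of _ r, symmetric])
  moreover have "K L0 f h *\<^sub>v (Z + f) = euler_eval n (K L0 f h) + K L0 f h *\<^sub>v f"
    using Kc fc by (simp add: euler_eval_def mult_add_distrib_mat_vec[of _ r n])
  \<comment> \<open>Here \<open>a\<close>, \<open>b\<close>, \<open>c\<close>, \<open>e\<close>,
    \<open>l\<close> stand for the Euler evaluations of \<open>K L0 f h\<close>, \<open>D h\<close>,
    \<open>K L0 f h * D f\<close>, the Jacobian of \<open>h\<close> and \<open>L0\<close>, and
    \<open>q\<close> for \<open>K L0 f h *\<^sub>v f\<close>.\<close>
  moreover have "b - e + l - c + q = a + q - e" if "a + c = b + l"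
    "a \<in> carrier_vec r" "b \<in> carrier_vec r" "c \<in> carrier_vec r" "e \<in> carrier_vec r"
    "l \<in> carrier_vec r" "q \<in> carrier_vec r" for a b c e l q :: "series vec"
  proof (rule eq_vecI)
    fix i
    assume "i < dim_vec (a + q - e)"
    then have i: "i < r" using that by auto
    have "a $ i + c $ i = b $ i + l $ i"
      using arg_cong[OF that(1), of "\<lambda>v. v $ i"] i that(2-) by simp
    then have "a $ i = b $ i + l $ i - c $ i" by (simp add: algebra_simps)
    then show "(b - e + l - c + q) $ i = (a + q - e) $ i" using i that(2-) by simp
  qed (use that in auto)
  ultimately show ?thesis
    unfolding remainder_def
    using euler_eval_carrier[OF Kc] euler_eval_carrier[OF Dc(2)] euler_eval_carrier[OF L0c]
      euler_eval_carrier[OF jc] euler_eval_carrier[OF mult_carrier_mat[OF Kc Dc(1)]]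
      mult_mat_vec_carrier[OF Kc fc]
    by presburger
qed

text \<open>Differentiation costs one order, so \<open>D f\<close>, \<open>D h\<close> and with them
  \<open>K\<close> change only in order \<open>j - 1\<close>. Two orders are regained in each term:
  from \<open>z\<close> together with \<open>L\<close> or with the factor \<open>D f\<close> or
  \<open>K\<close>, or from \<open>f\<close>, which has order 2. In
  \<open>K' *\<^sub>v (f - f')\<close> nothing is differentiated and the order 1 of
  \<open>K'\<close> suffices.\<close>

lemma remainder_contr:
  assumes f: "f \<in> vec_ideal V n 2" "f' \<in> vec_ideal V n 2"
    and h: "h \<in> vec_ideal V r 2" "h' \<in> vec_ideal V r 2"
    and L0: "L0 \<in> mat_ideal V r n 1"
    and ff: "f - f' \<in> vec_ideal V n j" and hh: "h - h' \<in> vec_ideal V r j"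
  shows "remainder L0 f h - remainder L0 f' h' \<in> vec_ideal V r (Suc j)"
proof (cases j)
  \<comment> \<open>No order is left for a derivative to consume, but both remainders have order 2
    in any case.\<close>
  case 0
  then show ?thesis
    using vec_ideal_diff[OF remainder_ideal[OF f(1) h(1) L0] remainder_ideal[OF f(2) h(2) L0]]
    by (auto elim: vec_ideal_antimono)
next
  case (Suc p)
  let ?K = "K L0 f h" and ?K' = "K L0 f' h'"
  note K1 = K[OF f(1) h(1) L0] and K2 = K[OF f(2) h(2) L0]
  have fc: "f \<in> carrier_vec n" "f' \<in> carrier_vec n" and hc: "h \<in> carrier_vec r" "h' \<in> carrier_vec r"
    and L0c: "L0 \<in> carrier_mat r n"
    using f h L0 by (auto intro: vec_ideal_carrier mat_ideal_carrier)
  note Kc = K1(1)[THEN mat_ideal_carrier] K2(1)[THEN mat_ideal_carrier]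
  note Dfc = D_carrier[OF fc(1)] D_carrier[OF fc(2)]
  note Dhc = D_carrier[OF hc(1)] D_carrier[OF hc(2)]
  note jc = jac_carrier[OF hc(1), of ZVar n] jac_carrier[OF hc(2), of ZVar n]
  have Df: "D f \<in> mat_ideal V n n 1" using f by (auto simp: numeral_2_eq_2 intro: D_ideal)
  have Dff: "D f - D f' \<in> mat_ideal V n n p" and Dhh: "D h - D h' \<in> mat_ideal V r n p"
    using ff hh D_ideal fc hc by (auto simp: Suc D_diff[symmetric])
  have K'Dff: "?K' * (D f - D f') \<in> mat_ideal V r n (Suc p)"
    using mat_ideal_mult[OF K2(1) Dff] by simp
  \<comment> \<open>The difference of the defining equations of \<open>?K\<close> and
    \<open>?K'\<close>, arranged so that a single factor \<open>1 + D f\<close> remains to be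
    divided out.\<close>
  have "(?K - ?K') * (1\<^sub>m n + D f) = (D h - D h') - ?K' * (D f - D f')"
  proof -
    have "1\<^sub>m n + D f = (1\<^sub>m n + D f') + (D f - D f')"
      using Dfc by (intro eq_matI) auto
    then have "?K' * (1\<^sub>m n + D f) = ?K' * (1\<^sub>m n + D f') + ?K' * (D f - D f')"
      using Kc Dfc by (metis add_carrier_mat minus_carrier_mat mult_add_distrib_mat)
    then have K': "?K' * (1\<^sub>m n + D f) = (D h' + L0) + ?K' * (D f - D f')"
      unfolding K2(2) .
    have "(?K - ?K') * (1\<^sub>m n + D f) = (D h + L0) - ((D h' + L0) + ?K' * (D f - D f'))"
      unfolding K'[symmetric] K1(2)[symmetric]
      using Kc Dfc by (simp add: minus_mult_distrib_mat[of _ r n _ _ n])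
    then show ?thesis
      using Dhc L0c Kc Dfc by (intro eq_matI) auto
  qed
  moreover have "\<dots> \<in> mat_ideal V r n p"
    by (rule mat_ideal_diff[OF Dhh mat_ideal_antimono[OF K'Dff]]) simp
  ultimately have KK: "?K - ?K' \<in> mat_ideal V r n p"
    using mat_right_div_ideal[OF Df mat_ideal_diff[OF K1(1) K2(1)]] by simp
  have "?K * D f - ?K' * D f' = (?K - ?K') * D f + ?K' * (D f - D f')"
  proof -
    have "(?K - ?K') * D f = ?K * D f - ?K' * D f"
      "?K' * (D f - D f') = ?K' * D f - ?K' * D f'"
      using Kc Dfc
      by (simp_all add: minus_mult_distrib_mat[of _ r n _ _ n] mult_minus_distrib_mat[of _ r n _ n])
    then show ?thesis using Kc Dfc by (intro eq_matI) auto
  qed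
  moreover have "(?K - ?K') * D f \<in> mat_ideal V r n (Suc p)"
    using mat_ideal_mult[OF KK Df] by simp
  ultimately have "?K * D f - ?K' * D f' \<in> mat_ideal V r n (Suc p)"
    using K'Dff by (simp add: mat_ideal_add)
  then have c: "euler_eval n (?K * D f) - euler_eval n (?K' * D f') \<in> vec_ideal V r (Suc j)"
    using euler_eval_ideal Kc Dfc unfolding Suc
    by (subst euler_eval_diff[symmetric, of _ r]) auto
  have "?K *\<^sub>v f - ?K' *\<^sub>v f' = (?K - ?K') *\<^sub>v f + ?K' *\<^sub>v (f - f')"
  proof -
    have "(?K - ?K') *\<^sub>v f = ?K *\<^sub>v f - ?K' *\<^sub>v f"
      "?K' *\<^sub>v (f - f') = ?K' *\<^sub>v f - ?K' *\<^sub>v f'"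
      using Kc fc
      by (simp_all add: minus_mult_distrib_mat_vec[of _ r n] mult_minus_distrib_mat_vec[of _ r n])
    then show ?thesis using Kc fc by (intro eq_vecI) auto
  qed
  moreover have "(?K - ?K') *\<^sub>v f \<in> vec_ideal V r (Suc j)"
    using mat_ideal_mult_vec[OF KK f(1)] by (simp add: Suc)
  moreover have "?K' *\<^sub>v (f - f') \<in> vec_ideal V r (Suc j)"
    using mat_ideal_mult_vec[OF K2(1) ff] by simp
  ultimately have q: "?K *\<^sub>v f - ?K' *\<^sub>v f' \<in> vec_ideal V r (Suc j)"
    by (simp add: vec_ideal_add)
  \<comment> \<open>This term is linear in \<open>h\<close>, so the estimate is
    \<open>euler_D\<close> for \<open>h - h'\<close>.\<close>
  have b: "(euler_eval n (D h) - euler_eval n (jac ZVar n h))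
      - (euler_eval n (D h') - euler_eval n (jac ZVar n h')) \<in> vec_ideal V r (Suc j)"
  proof -
    have "euler_eval n (D (h - h')) - euler_eval n (jac ZVar n (h - h')) \<in> vec_ideal V r (Suc j)"
      using euler_D[of "h - h'" r p] hh by (simp add: Suc)
    moreover have "euler_eval n (D (h - h')) - euler_eval n (jac ZVar n (h - h'))
      = (euler_eval n (D h) - euler_eval n (jac ZVar n h))
      - (euler_eval n (D h') - euler_eval n (jac ZVar n h'))"
      using euler_eval_carrier[OF Dhc(1)] euler_eval_carrier[OF Dhc(2)]
        euler_eval_carrier[OF jc(1)] euler_eval_carrier[OF jc(2)]
      unfolding D_diff[OF hc] jac_diff[OF hc] euler_eval_diff[OF Dhc] euler_eval_diff[OF jc]
      by (intro eq_vecI) (auto simp: algebra_simps)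
    ultimately show ?thesis by simp
  qed
  have regroup: "(b + l - c + q) - (b' + l - c' + q') = (b - b') - (c - c') + (q - q')"
    if "b \<in> carrier_vec r" "b' \<in> carrier_vec r" "c \<in> carrier_vec r" "c' \<in> carrier_vec r"
      "q \<in> carrier_vec r" "q' \<in> carrier_vec r" "l \<in> carrier_vec r"
    for b b' c c' l q q' :: "series vec"
    using that by (intro eq_vecI) (auto simp: algebra_simps)
  show ?thesis
    unfolding remainder_eq[OF f(1) h(1) L0] remainder_eq[OF f(2) h(2) L0]
    by (subst regroup, insert Kc Dfc Dhc jc L0c fc)
      (auto intro!: vec_ideal_add vec_ideal_diff b c q euler_eval_carrier
        mult_carrier_mat mult_mat_vec_carrier minus_carrier_vec)
qed

end

section \<open>Composition with a near-identity map\<close>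

definition shift :: "series vec \<Rightarrow> series vec \<Rightarrow> coord \<Rightarrow> series" where
  "shift f g v = (case v of
     ZVar j \<Rightarrow> mps_X (ZVar j) + f $ j
   | ZbarVar j \<Rightarrow> mps_X (ZbarVar j) + series_cnj (f $ j)
   | UVar j \<Rightarrow> mps_X (UVar j) + g $ j)"

lemma compose_id_plus_eq: "compose_id_plus f g = mps_subst (shift f g)"
  unfolding compose_id_plus_def shift_def ..

lemma near_identity_shift:
  assumes "f \<in> vec_ideal (coords n d) n 2" "g \<in> vec_ideal (coords n d) d 2"
  shows "near_identity (coords n d) (shift f g)"
proof
  show "shift f g v - mps_X v \<in> mps_ideal (coords n d) 2" if v: "v \<in> coords n d" for v
  proof (cases v)
    case (ZVar j)
    moreover have "j < n" using v ZVar by (auto simp: coords_def)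
    ultimately show ?thesis using vec_idealD[OF assms(1)] by (simp add: shift_def)
  next
    case (ZbarVar j)
    moreover have "j < n" using v ZbarVar by (auto simp: coords_def)
    ultimately show ?thesis using vec_idealD[OF assms(1)] by (simp add: shift_def)
  next
    case (UVar j)
    moreover have "j < d" using v UVar by (auto simp: coords_def)
    ultimately show ?thesis using vec_idealD[OF assms(2)] by (simp add: shift_def)
  qed
qed (rule finite_coords)

lemma series_cnj_shift:
  assumes "\<forall>j<d. real_valued (g $ j)" "v \<in> coords n d"
  shows "series_cnj (shift f g v) = shift f g (conj_coord v)"
  using assms by (auto simp: coords_def shift_def series_cnj_add real_valued_def)

lemma series_cnj_mono_subst_shift:
  assumes g: "\<forall>j<d. real_valued (g $ j)" and "Poly_Mapping.keys a \<subseteq> coords n d"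
  shows "series_cnj (mono_subst (shift f g) a) = mono_subst (shift f g) (conj_mono a)"
  using assms(2)
proof (induction a rule: mono_induct)
  case (single a v)
  then have "series_cnj (shift f g v) = shift f g (conj_coord v)"
    using series_cnj_shift[OF g] by (auto simp: keys_add_nat)
  then show ?case
    using single by (simp add: mono_subst_add series_cnj_mult conj_mono_add conj_mono_single keys_add_nat)
qed simp

lemma series_cnj_over [simp]:
  "series_cnj F \<in> mps_over (coords n d) \<longleftrightarrow> F \<in> mps_over (coords n d)"
  using series_cnj_ideal[of F n d 0] by (simp add: mps_ideal_def)

text \<open>The map commutes with conjugation: its \<open>zbar\<close> component is the conjugate of
  its \<open>z\<close> component by construction, and its \<open>u\<close> component is real.
  Conjugation then only permutes the monomials of the expansion.\<close>

lemma compose_cnj: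
  assumes f: "f \<in> vec_ideal (coords n d) n 2" and g: "g \<in> vec_ideal (coords n d) d 2"
    and real: "\<forall>j<d. real_valued (g $ j)" and F: "F \<in> mps_over (coords n d)"
  shows "compose_id_plus f g (series_cnj F) = series_cnj (compose_id_plus f g F)"
proof (rule mps_eqI)
  interpret near_identity "coords n d" "shift f g" by (rule near_identity_shift[OF f g])
  fix m
  let ?\<phi> = "mono_subst (shift f g)"
  have "mps_coeff (series_cnj (compose_id_plus f g F)) m =
      (\<Sum>a\<in>monos_upto (mono_deg m). cnj (mps_coeff F a) * cnj (mps_coeff (?\<phi> a) (conj_mono m)))"
    using F by (simp add: compose_id_plus_eq mps_coeff_subst[where k = "mono_deg m"])
  also have "\<dots> = (\<Sum>a\<in>monos_upto (mono_deg m).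
      cnj (mps_coeff F (conj_mono a)) * mps_coeff (?\<phi> a) m)"
  proof (rule sum.reindex_bij_witness[where i = conj_mono and j = conj_mono])
    fix a
    assume "a \<in> monos_upto (mono_deg m)"
    then have "mps_coeff (?\<phi> (conj_mono a)) m = cnj (mps_coeff (?\<phi> a) (conj_mono m))"
      using series_cnj_mono_subst_shift[OF real, of a n f]
        mps_coeff_series_cnj[of "?\<phi> a" m] by simp
    then show "cnj (mps_coeff F (conj_mono (conj_mono a))) * mps_coeff (?\<phi> (conj_mono a)) m =
        cnj (mps_coeff F a) * cnj (mps_coeff (?\<phi> a) (conj_mono m))" by simp
  qed simp_all
  also have "\<dots> = mps_coeff (compose_id_plus f g (series_cnj F)) m"
    using F by (simp add: compose_id_plus_eq mps_coeff_subst[where k = "mono_deg m"])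
  finally show "mps_coeff (compose_id_plus f g (series_cnj F)) m =
      mps_coeff (series_cnj (compose_id_plus f g F)) m" ..
qed

lemma series_Re_over: "F \<in> mps_over (coords n d) \<Longrightarrow> series_Re F \<in> mps_over (coords n d)"
  using series_Re_ideal[of F n d 0] by (simp add: mps_ideal_def)

text \<open>Once doubled, the real part is a plain sum, so that additivity of substitution is all
  that \<open>compose_Re\<close> has to use.\<close>

lemma double_series_Re: "series_Re F + series_Re F = F + series_cnj F"
  by (rule mps_eqI) (simp only: mps_coeff_add mps_coeff_series_Re mps_coeff_series_cnj, simp)

lemma compose_Re:
  assumes f: "f \<in> vec_ideal (coords n d) n 2" and g: "g \<in> vec_ideal (coords n d) d 2"
    and real: "\<forall>j<d. real_valued (g $ j)" and F: "F \<in> mps_over (coords n d)"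
  shows "compose_id_plus f g (series_Re F) = series_Re (compose_id_plus f g F)"
proof (rule mps_eqI)
  interpret near_identity "coords n d" "shift f g" by (rule near_identity_shift[OF f g])
  let ?C = "compose_id_plus f g"
  have "?C (series_Re F) + ?C (series_Re F) = ?C (F + series_cnj F)"
    unfolding compose_id_plus_eq double_series_Re[symmetric]
    by (rule subst_add[OF series_Re_over[OF F] series_Re_over[OF F], symmetric])
  also have "\<dots> = ?C F + series_cnj (?C F)"
    unfolding compose_cnj[OF assms, symmetric] using F
    unfolding compose_id_plus_eq by (intro subst_add) auto
  also have "\<dots> = series_Re (?C F) + series_Re (?C F)" by (simp add: double_series_Re)
  finally have eq: "?C (series_Re F) + ?C (series_Re F) = series_Re (?C F) + series_Re (?C F)" .
  show "mps_coeff (?C (series_Re F)) m = mps_coeff (series_Re (?C F)) m" for m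
    using arg_cong[OF eq, of "\<lambda>G. mps_coeff G m"] unfolding mps_coeff_add by simp
qed

text \<open>Substitution respects sums and products and sends \<open>z\<close> to
  \<open>z + f\<close>. With \<open>A\<close> a block of \<open>L'\<close>, this expresses
  \<open>L' z'\<close> at the image point through \<open>K\<close>.\<close>

lemma compose_euler_eval:
  assumes f: "f \<in> vec_ideal (coords n d) n 2" and g: "g \<in> vec_ideal (coords n d) d 2"
    and A: "A \<in> mat_ideal (coords n d) r n k"
  shows "map_vec (compose_id_plus f g) (euler_eval n A) =
    map_mat (compose_id_plus f g) A *\<^sub>v (vec n (\<lambda>j. mps_X (ZVar j)) + f)"
proof (rule eq_vecI)
  interpret near_identity "coords n d" "shift f g" by (rule near_identity_shift[OF f g])
  note Ac = A[THEN mat_ideal_carrier]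
  have fc: "f \<in> carrier_vec n" using f by (rule vec_ideal_carrier)
  show "dim_vec (map_vec (compose_id_plus f g) (euler_eval n A)) =
      dim_vec (map_mat (compose_id_plus f g) A *\<^sub>v (vec n (\<lambda>j. mps_X (ZVar j)) + f))"
    using Ac by (simp add: euler_eval_def)
  fix i
  assume "i < dim_vec (map_mat (compose_id_plus f g) A *\<^sub>v (vec n (\<lambda>j. mps_X (ZVar j)) + f))"
  then have i: "i < r" using Ac by simp
  have Aij: "A $$ (i, j) \<in> mps_over (coords n d)" if "j < n" for j
    using mat_idealD[OF A i that] by (rule mps_over_ideal)
  have Z: "ZVar j \<in> coords n d" "mps_X (ZVar j) \<in> mps_over (coords n d)" if "j < n" for j
    using that mps_over_ideal[OF mps_ideal_X[of "ZVar j" "coords n d"]] by (auto simp: coords_def)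
  have prod: "A $$ (i, j) * mps_X (ZVar j) \<in> mps_over (coords n d)" if "j < n" for j
    using mps_ideal_mult[of "A $$ (i, j)" "coords n d" 0 "mps_X (ZVar j)" 0] Aij[OF that] Z[OF that]
    by (simp add: mps_ideal_def)
  have "compose_id_plus f g (euler_eval n A $ i) =
      (\<Sum>j<n. mps_subst (shift f g) (A $$ (i, j) * mps_X (ZVar j)))"
    unfolding compose_id_plus_eq euler_vec_mult[OF Ac i] by (rule subst_sum) (simp add: prod)
  also have "\<dots> = (\<Sum>j<n. mps_subst (shift f g) (A $$ (i, j)) * (mps_X (ZVar j) + f $ j))"
  proof (rule sum.cong)
    fix j
    assume "j \<in> {..<n}"
    then have j: "j < n" by simp
    show "mps_subst (shift f g) (A $$ (i, j) * mps_X (ZVar j)) =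
        mps_subst (shift f g) (A $$ (i, j)) * (mps_X (ZVar j) + f $ j)"
      using subst_mult[OF Aij[OF j] Z(2)[OF j]] subst_X[OF Z(1)[OF j]] by (simp add: shift_def)
  qed simp
  also have "\<dots> = (map_mat (compose_id_plus f g) A *\<^sub>v (vec n (\<lambda>j. mps_X (ZVar j)) + f)) $ i"
    using Ac fc i
    by (auto simp: scalar_prod_def compose_id_plus_eq atLeast0LessThan intro!: sum.cong)
  finally show "map_vec (compose_id_plus f g) (euler_eval n A) $ i =
      (map_mat (compose_id_plus f g) A *\<^sub>v (vec n (\<lambda>j. mps_X (ZVar j)) + f)) $ i"
    using Ac i by (simp add: euler_eval_def)
qed

text \<open>Recovers \<open>L'\<close> from its composition with the map, entry by entry through
  \<open>subst_surj\<close>; hence the transformed structure exists.\<close>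

lemma map_mat_compose_surj:
  assumes f: "f \<in> vec_ideal (coords n d) n 2" and g: "g \<in> vec_ideal (coords n d) d 2"
    and B: "B \<in> mat_ideal (coords n d) r c k"
  obtains A where "A \<in> mat_ideal (coords n d) r c k" "map_mat (compose_id_plus f g) A = B"
proof -
  interpret near_identity "coords n d" "shift f g" by (rule near_identity_shift[OF f g])
  have ex: "\<exists>F. F \<in> mps_ideal (coords n d) k \<and> mps_subst (shift f g) F = B $$ (i, j)"
    if "i < r" "j < c" for i j
    using subst_surj[OF mat_idealD[OF B that]] by metis
  define F where "F p = (SOME F. F \<in> mps_ideal (coords n d) k \<and> mps_subst (shift f g) F = B $$ p)" for p
  have F: "F (i, j) \<in> mps_ideal (coords n d) k \<and> mps_subst (shift f g) (F (i, j)) = B $$ (i, j)"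
    if "i < r" "j < c" for i j
    unfolding F_def using someI_ex[OF ex[OF that]] .
  show ?thesis
  proof (rule that)
    show "mat r c F \<in> mat_ideal (coords n d) r c k" using F by (auto simp: mat_ideal_def)
    show "map_mat (compose_id_plus f g) (mat r c F) = B"
      using F mat_ideal_carrier[OF B] by (intro eq_matI) (auto simp: compose_id_plus_eq)
  qed
qed

lemma map_mat_compose_ideal:
  assumes f: "f \<in> vec_ideal (coords n d) n 2" and g: "g \<in> vec_ideal (coords n d) d 2"
    and A: "A \<in> mat_ideal (coords n d) r c k"
  shows "map_mat (compose_id_plus f g) A \<in> mat_ideal (coords n d) r c k"
proof -
  interpret near_identity "coords n d" "shift f g" by (rule near_identity_shift[OF f g])
  show ?thesis using A subst_ideal by (auto simp: mat_ideal_def compose_id_plus_eq)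
qed

text \<open>The solution of \<open>w h = G\<close>, for the operator \<open>w\<close> multiplying the coefficient of a monomial \<open>m\<close> by
  \<open>w m\<close>, whose component in the kernel is that of \<open>F\<close>; the component of \<open>G\<close> in the cokernel is
  ignored.\<close>

definition euler_solve :: "((coord \<Rightarrow>\<^sub>0 nat) \<Rightarrow> nat) \<Rightarrow> series \<Rightarrow> series \<Rightarrow> series" where
  "euler_solve w F G = Abs_mps (\<lambda>m. if w m = 0 then mps_coeff F m else mps_coeff G m / of_nat (w m))"

lemma mps_coeff_euler_solve:
  "mps_coeff (euler_solve w F G) m = (if w m = 0 then mps_coeff F m else mps_coeff G m / of_nat (w m))"
  by (simp add: euler_solve_def)

lemma euler_solve_ideal:
  assumes "F \<in> mps_ideal V k" "G \<in> mps_ideal V k"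
  shows "euler_solve w F G \<in> mps_ideal V k"
  using assms unfolding mps_ideal_iff mps_coeff_euler_solve by (metis div_0)

lemma euler_solve_diff_ideal:
  assumes "G - G' \<in> mps_ideal V k"
  shows "euler_solve w F G - euler_solve w F G' \<in> mps_ideal V k"
  unfolding mps_ideal_iff
proof (intro allI impI)
  fix m
  assume "mps_coeff (euler_solve w F G - euler_solve w F G') m \<noteq> 0"
  then have "mps_coeff (G - G') m \<noteq> 0"
    by (auto simp: mps_coeff_euler_solve split: if_splits)
  then show "Poly_Mapping.keys m \<subseteq> V \<and> k \<le> mono_deg m"
    using assms unfolding mps_ideal_iff by blast
qed

lemma euler_solve_eq_iff:
  "euler_solve w F G = H \<longleftrightarrow>
     (\<forall>m. w m = 0 \<longrightarrow> mps_coeff H m = mps_coeff F m) \<and>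
     (\<forall>m. w m \<noteq> 0 \<longrightarrow> of_nat (w m) * mps_coeff H m = mps_coeff G m)"
proof -
  have "euler_solve w F G = H \<longleftrightarrow> (\<forall>m. mps_coeff (euler_solve w F G) m = mps_coeff H m)"
    by (auto intro: mps_eqI)
  then show ?thesis by (auto simp: mps_coeff_euler_solve field_simps)
qed

lemma real_valued_euler_solve:
  assumes "real_valued F" "real_valued G" "\<And>m. w (conj_mono m) = w m"
  shows "real_valued (euler_solve w F G)"
proof -
  have "cnj (mps_coeff F (conj_mono m)) = mps_coeff F m" "cnj (mps_coeff G (conj_mono m)) = mps_coeff G m"
    for m using assms(1,2) unfolding real_valued_def by (metis mps_coeff_series_cnj)+
  then show ?thesis
    unfolding real_valued_def by (intro mps_eqI) (simp add: mps_coeff_euler_solve assms(3))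
qed

section \<open>The normalization equations\<close>

lemma formal_almost_CR_iff:
  "formal_almost_CR n d Lzb Lw \<longleftrightarrow>
     Lzb \<in> mat_ideal (coords n d) n n 1 \<and> Lw \<in> mat_ideal (coords n d) d n 1"
proof -
  have elements: "(\<forall>F \<in> elements_mat A. P F) \<longleftrightarrow> (\<forall>i<r. \<forall>j<c. P (A $$ (i, j)))"
    if "A \<in> carrier_mat r c" for A :: "series mat" and r c P
    using that unfolding elements_mat_def by auto
  show ?thesis
    unfolding formal_almost_CR_def mat_ideal_def mps_ideal_1_iff ball_Un
    by (simp add: elements cong: conj_cong) (rule iffI; elim conjE; intro conjI; assumption)
qed

context almost_CR
begin

lemma zero_vec_ideal: "0\<^sub>v r \<in> vec_ideal V r k"
  by (auto simp: vec_ideal_def)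

text \<open>The transformation law is the defining equation of \<open>K\<close>, and the factor
  \<open>1 + D f\<close> can be cancelled.\<close>

lemma K_eq_compose:
  assumes f: "f \<in> vec_ideal V n 2" and g: "g \<in> vec_ideal V d 2"
    and h: "h \<in> vec_ideal V r 2" and L0: "L0 \<in> mat_ideal V r n 1"
    and X: "X \<in> mat_ideal V r n 1"
  shows "D h + L0 = map_mat (compose_id_plus f g) X * (1\<^sub>m n + D f) \<longleftrightarrow>
    map_mat (compose_id_plus f g) X = K L0 f h"
proof -
  have "D f \<in> mat_ideal V n n 1" using f by (auto simp: numeral_2_eq_2 intro: D_ideal)
  then show ?thesis
    using mat_right_cancel[OF _ map_mat_compose_ideal[OF f g X] K(1)[OF f h L0]] K(2)[OF f h L0]
    by metis
qed

lemma along_euler: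
  assumes f: "f \<in> vec_ideal V n 2" and g: "g \<in> vec_ideal V d 2"
    and X: "X \<in> mat_ideal V r n 1" and eq: "map_mat (compose_id_plus f g) X = K L0 f h"
  shows "K L0 f h *\<^sub>v (Z + f) = map_vec (compose_id_plus f g) (euler_eval n X)"
  using compose_euler_eval[OF f g X] eq by simp

text \<open>A vanishing series has vanishing composition. Conversely, monomials free of
  \<open>z\<close> are missing from \<open>L' z'\<close> and the remaining ones from its
  composition, so \<open>subst_eq_zero\<close> applies.\<close>

lemma f_equation_iff:
  assumes f: "f \<in> vec_ideal V n 2" and g: "g \<in> vec_ideal V d 2"
    and X: "X \<in> mat_ideal V n n 1" and eq: "map_mat (compose_id_plus f g) X = K Lzb f h"
  shows "euler_eval n X = 0\<^sub>v n \<longleftrightarrow>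
    (\<forall>i<n. \<forall>m. z_deg n m \<noteq> 0 \<longrightarrow> mps_coeff ((K Lzb f h *\<^sub>v (Z + f)) $ i) m = 0)"
proof -
  interpret near_identity V "shift f g" by (rule near_identity_shift[OF f g])
  note K = along_euler[OF f g X eq]
  have Xc: "X \<in> carrier_mat n n" using X by (rule mat_ideal_carrier)
  have c: "euler_eval n X \<in> carrier_vec n" by (rule euler_eval_carrier[OF Xc])
  show ?thesis
  proof
    assume "euler_eval n X = 0\<^sub>v n"
    then show "\<forall>i<n. \<forall>m. z_deg n m \<noteq> 0 \<longrightarrow> mps_coeff ((K Lzb f h *\<^sub>v (Z + f)) $ i) m = 0"
      unfolding K by (simp add: compose_id_plus_eq)
  next
    assume *: "\<forall>i<n. \<forall>m. z_deg n m \<noteq> 0 \<longrightarrow> mps_coeff ((K Lzb f h *\<^sub>v (Z + f)) $ i) m = 0"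
    have "euler_eval n X $ i = 0" if i: "i < n" for i
    proof (rule subst_eq_zero)
      show "euler_eval n X $ i \<in> mps_over V"
        by (rule mps_over_ideal[OF vec_idealD[OF euler_eval_ideal[OF X] i]])
      show "mps_coeff (euler_eval n X $ i) m = 0 \<or>
          mps_coeff (mps_subst (shift f g) (euler_eval n X $ i)) m = 0" for m
        using mps_coeff_euler_eval_eq_0[OF Xc i, of m] * i c
        unfolding K by (auto simp: compose_id_plus_eq)
    qed
    then show "euler_eval n X = 0\<^sub>v n" using c by (intro eq_vecI) auto
  qed
qed

text \<open>The argument for the first block is repeated for the real part, which commutes with
  composition because the map is real. Only the monomials free of both \<open>z\<close> and
  \<open>zbar\<close> are now excluded in advance.\<close>

lemma g_equation_iff:
  assumes f: "f \<in> vec_ideal V n 2" and g: "g \<in> vec_ideal V d 2" and real: "\<forall>j<d. real_valued (g $ j)"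
    and X: "X \<in> mat_ideal V d n 1" and eq: "map_mat (compose_id_plus f g) X = K Lw f h"
  shows "map_vec series_Re (euler_eval n X) = 0\<^sub>v d \<longleftrightarrow>
    (\<forall>i<d. \<forall>m. z_deg n m + zbar_deg n m \<noteq> 0 \<longrightarrow>
      mps_coeff (series_Re ((K Lw f h *\<^sub>v (Z + f)) $ i)) m = 0)"
proof -
  interpret near_identity V "shift f g" by (rule near_identity_shift[OF f g])
  note K = along_euler[OF f g X eq]
  have Xc: "X \<in> carrier_mat d n" using X by (rule mat_ideal_carrier)
  have c: "euler_eval n X \<in> carrier_vec d" by (rule euler_eval_carrier[OF Xc])
  have over: "euler_eval n X $ i \<in> mps_over V" if i: "i < d" for i
    by (rule mps_over_ideal[OF vec_idealD[OF euler_eval_ideal[OF X] i]])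
  have Re: "series_Re ((K Lw f h *\<^sub>v (Z + f)) $ i) =
      mps_subst (shift f g) (series_Re (euler_eval n X $ i))" if i: "i < d" for i
    using compose_Re[OF f g real over[OF i]] i c unfolding K by (simp add: compose_id_plus_eq)
  show ?thesis
  proof
    assume zero: "map_vec series_Re (euler_eval n X) = 0\<^sub>v d"
    have "series_Re (euler_eval n X $ i) = 0" if "i < d" for i
      using arg_cong[OF zero, of "\<lambda>v. v $ i"] that c by simp
    then show "\<forall>i<d. \<forall>m. z_deg n m + zbar_deg n m \<noteq> 0 \<longrightarrow>
        mps_coeff (series_Re ((K Lw f h *\<^sub>v (Z + f)) $ i)) m = 0"
      by (simp add: Re)
  next
    assume *: "\<forall>i<d. \<forall>m. z_deg n m + zbar_deg n m \<noteq> 0 \<longrightarrow>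
        mps_coeff (series_Re ((K Lw f h *\<^sub>v (Z + f)) $ i)) m = 0"
    have "series_Re (euler_eval n X $ i) = 0" if i: "i < d" for i
    proof (rule subst_eq_zero)
      show "series_Re (euler_eval n X $ i) \<in> mps_over V"
        by (rule series_Re_over[OF over[OF i]])
      fix m
      show "mps_coeff (series_Re (euler_eval n X $ i)) m = 0 \<or>
          mps_coeff (mps_subst (shift f g) (series_Re (euler_eval n X $ i))) m = 0"
      proof (cases "z_deg n m + zbar_deg n m = 0")
        case True
        \<comment> \<open>Neither \<open>m\<close> nor its conjugate contains a \<open>z\<close>
          variable, so both terms of the real part vanish.\<close>
        then show ?thesis
          using mps_coeff_euler_eval_eq_0[OF Xc i, of m]
            mps_coeff_euler_eval_eq_0[OF Xc i, of "conj_mono m"]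
          by (simp add: mps_coeff_series_Re)
      next
        case False
        then have "mps_coeff (series_Re ((K Lw f h *\<^sub>v (Z + f)) $ i)) m = 0" using * i by blast
        then show ?thesis unfolding Re[OF i] ..
      qed
    qed
    then show "map_vec series_Re (euler_eval n X) = 0\<^sub>v d" using c by (intro eq_vecI) auto
  qed
qed

text \<open>Eliminates \<open>L'\<close>: the transformation law fixes its composition with the map
  as \<open>K\<close>, and surjectivity of substitution provides such an \<open>L'\<close>. What
  remains are equations for \<open>f\<close> and \<open>g\<close> alone, the first of which does not
  involve \<open>g\<close>.\<close>

lemma normalization_iff:
  assumes f: "f \<in> vec_ideal V n 2" and g: "g \<in> vec_ideal V d 2" and real: "\<forall>j<d. real_valued (g $ j)"
  shows "(\<exists>Lzb' Lw'. formal_almost_CR n d Lzb' Lw' \<and> transforms n d f g Lzb Lw Lzb' Lw' \<and>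
      euler_eval n Lzb' = 0\<^sub>v n \<and> map_vec series_Re (euler_eval n Lw') = 0\<^sub>v d) \<longleftrightarrow>
    (\<forall>i<n. \<forall>m. z_deg n m \<noteq> 0 \<longrightarrow>
      mps_coeff ((K Lzb f (map_vec series_cnj f) *\<^sub>v (Z + f)) $ i) m = 0) \<and>
    (\<forall>i<d. \<forall>m. z_deg n m + zbar_deg n m \<noteq> 0 \<longrightarrow>
      mps_coeff (series_Re ((K Lw f g *\<^sub>v (Z + f)) $ i)) m = 0)"
    (is "?L \<longleftrightarrow> ?R")
proof -
  let ?C = "map_mat (compose_id_plus f g)" and ?fb = "map_vec series_cnj f"
  have fb: "?fb \<in> vec_ideal V n 2" by (rule map_vec_cnj_ideal[OF f])
  note c = f[THEN vec_ideal_carrier] g[THEN vec_ideal_carrier] fb[THEN vec_ideal_carrier]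
  \<comment> \<open>The three matrix expressions in \<open>transforms\<close> are brought into the
    form used in the defining equation of \<open>K\<close>.\<close>
  have T: "1\<^sub>m n + jac ZVar n f + jac ZbarVar n f * Lzb + jac UVar d f * Lw = 1\<^sub>m n + D f"
    unfolding D_def using jac_carrier[OF c(1), of ZVar n] jac_carrier[OF c(1), of ZbarVar n]
      jac_carrier[OF c(1), of UVar d] Lzb_carrier Lw_carrier
    by (simp add: assoc_add_mat[of _ n n])
  have B: "jac ZVar n g + jac ZbarVar n g * Lzb + (1\<^sub>m d + jac UVar d g) * Lw = D g + Lw"
  proof -
    note j = jac_carrier[OF c(2), of ZVar n] jac_carrier[OF c(2), of ZbarVar n]
      jac_carrier[OF c(2), of UVar d]
    have "(1\<^sub>m d + jac UVar d g) * Lw = Lw + jac UVar d g * Lw"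
      using j Lw_carrier by (simp add: add_mult_distrib_mat[of _ d d _ _ n])
    moreover have "a + b + (l + e) = a + b + e + l"
      if "a \<in> carrier_mat d n" "b \<in> carrier_mat d n" "e \<in> carrier_mat d n" "l \<in> carrier_mat d n"
      for a b e l :: "series mat"
      using that by (intro eq_matI) auto
    moreover note this[OF j(1) mult_carrier_mat[OF j(2) Lzb_carrier] mult_carrier_mat[OF j(3) Lw_carrier] Lw_carrier]
    ultimately show ?thesis unfolding D_def by simp
  qed
  have A: "jac ZVar n ?fb + (1\<^sub>m n + jac ZbarVar n ?fb) * Lzb + jac UVar d ?fb * Lw = D ?fb + Lzb"
  proof -
    note j = jac_carrier[OF c(3), of ZVar n] jac_carrier[OF c(3), of ZbarVar n]
      jac_carrier[OF c(3), of UVar d]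
    have "(1\<^sub>m n + jac ZbarVar n ?fb) * Lzb = Lzb + jac ZbarVar n ?fb * Lzb"
      using j Lzb_carrier by (simp add: add_mult_distrib_mat[of _ n n _ _ n])
    moreover have "a + (l + b) + e = a + b + e + l"
      if "a \<in> carrier_mat n n" "b \<in> carrier_mat n n" "e \<in> carrier_mat n n" "l \<in> carrier_mat n n"
      for a b e l :: "series mat"
      using that by (intro eq_matI) auto
    moreover note this[OF j(1) mult_carrier_mat[OF j(2) Lzb_carrier] mult_carrier_mat[OF j(3) Lw_carrier] Lzb_carrier]
    ultimately show ?thesis unfolding D_def by simp
  qed
  note CR = formal_almost_CR_iff
  have tr: "transforms n d f g Lzb Lw Lzb' Lw' \<longleftrightarrow> ?C Lw' = K Lw f g \<and> ?C Lzb' = K Lzb f ?fb"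
    if "Lzb' \<in> mat_ideal V n n 1" "Lw' \<in> mat_ideal V d n 1" for Lzb' Lw'
    unfolding transforms_def Let_def T A B
    using K_eq_compose[OF f g g Lw that(2)] K_eq_compose[OF f g fb Lzb that(1)] by simp
  \<comment> \<open>Witnesses for the direction from the equations to the existence of
    \<open>L'\<close>.\<close>
  obtain Lzb' where Lzb': "Lzb' \<in> mat_ideal V n n 1" "?C Lzb' = K Lzb f ?fb"
    by (rule map_mat_compose_surj[OF f g K(1)[OF f fb Lzb]])
  obtain Lw' where Lw': "Lw' \<in> mat_ideal V d n 1" "?C Lw' = K Lw f g"
    by (rule map_mat_compose_surj[OF f g K(1)[OF f g Lw]])
  show ?thesis
  proof
    assume ?L
    then obtain A B where CR': "formal_almost_CR n d A B" and tr': "transforms n d f g Lzb Lw A B"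
      and zero: "euler_eval n A = 0\<^sub>v n" "map_vec series_Re (euler_eval n B) = 0\<^sub>v d"
      by (elim exE conjE)
    have A: "A \<in> mat_ideal V n n 1" and B: "B \<in> mat_ideal V d n 1"
      using CR' unfolding CR by (rule conjunct1, rule conjunct2)
    have "?C B = K Lw f g" "?C A = K Lzb f ?fb"
      using tr' unfolding tr[OF A B] by (rule conjunct1, rule conjunct2)
    with zero show ?R
      unfolding f_equation_iff[OF f g A \<open>?C A = _\<close>] g_equation_iff[OF f g real B \<open>?C B = _\<close>]
      by (intro conjI)
  next
    assume ?R
    then have "euler_eval n Lzb' = 0\<^sub>v n" "map_vec series_Re (euler_eval n Lw') = 0\<^sub>v d"
      unfolding f_equation_iff[OF f g Lzb'] g_equation_iff[OF f g real Lw']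
      by (rule conjunct1, rule conjunct2)
    moreover have "formal_almost_CR n d Lzb' Lw'"
      unfolding CR using Lzb'(1) Lw'(1) by (rule conjI)
    moreover have "transforms n d f g Lzb Lw Lzb' Lw'"
      unfolding tr[OF Lzb'(1) Lw'(1)] using Lw'(2) Lzb'(2) by (rule conjI)
    ultimately show ?L by (intro exI conjI)
  qed
qed

section \<open>The fixed point equations for \<open>f\<close> and for \<open>g\<close>\<close>

text \<open>The equation reads \<open>z_deg\<close> times \<open>fbar\<close> equals minus the
  remainder. Conjugated into an equation for \<open>f\<close>, its weight becomes
  \<open>zbar_deg\<close>, whose kernel consists of the monomials free of \<open>zbar\<close>, where
  \<open>f0\<close> prescribes the coefficients.\<close>

definition f_step :: "series vec \<Rightarrow> series vec \<Rightarrow> series vec" where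
  "f_step f0 f = vec n (\<lambda>i. euler_solve (zbar_deg n) (f0 $ i)
     (- series_cnj (remainder Lzb f (map_vec series_cnj f) $ i)))"

lemma map_vec_cnj_diff:
  "f \<in> carrier_vec r \<Longrightarrow> f' \<in> carrier_vec r \<Longrightarrow>
    map_vec series_cnj (f - f') = map_vec series_cnj f - map_vec series_cnj f'"
  by (intro eq_vecI) (auto simp: series_cnj_diff)

lemma f_step_unique_fixpoint:
  assumes f0: "f0 \<in> vec_ideal V n 2"
  shows "\<exists>!f. f \<in> vec_ideal V n 2 \<and> f_step f0 f = f"
proof (rule vec_contraction_unique_fixpoint)
  fix f :: "series vec"
  assume f: "f \<in> vec_ideal V n 2"
  show "f_step f0 f \<in> vec_ideal V n 2"
    using remainder_ideal[OF f map_vec_cnj_ideal[OF f] Lzb] f0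
    unfolding f_step_def vec_ideal_def by (auto intro!: euler_solve_ideal mps_ideal_uminus)
next
  fix f f' :: "series vec" and j
  assume f: "f \<in> vec_ideal V n 2" and f': "f' \<in> vec_ideal V n 2" and ff: "f - f' \<in> vec_ideal V n j"
  \<comment> \<open>Conjugation preserves the filtration, so \<open>remainder_contr\<close> applies
    with \<open>fbar\<close> in the place of \<open>h\<close>.\<close>
  have "map_vec series_cnj f - map_vec series_cnj f' \<in> vec_ideal V n j"
    using map_vec_cnj_ideal[OF ff] map_vec_cnj_diff vec_ideal_carrier[OF f] vec_ideal_carrier[OF f']
    by metis
  note R = remainder_contr[OF f f' map_vec_cnj_ideal[OF f] map_vec_cnj_ideal[OF f'] Lzb ff this]
  let ?R = "\<lambda>f. remainder Lzb f (map_vec series_cnj f)"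
  have R': "?R f' \<in> carrier_vec n"
    using remainder_ideal[OF f' map_vec_cnj_ideal[OF f'] Lzb] by (rule vec_ideal_carrier)
  have "- series_cnj (?R f $ i) - - series_cnj (?R f' $ i) \<in> mps_ideal V (Suc j)" if i: "i < n" for i
  proof -
    have "- series_cnj (?R f $ i) - - series_cnj (?R f' $ i) = - series_cnj ((?R f - ?R f') $ i)"
      using i R' by (simp add: series_cnj_diff)
    then show ?thesis using vec_idealD[OF R i] by (simp add: mps_ideal_uminus)
  qed
  then show "f_step f0 f - f_step f0 f' \<in> vec_ideal V n (Suc j)"
    unfolding f_step_def vec_ideal_def by (auto intro!: euler_solve_diff_ideal)
qed

lemma f_step_fixpoint_iff:
  assumes f: "f \<in> vec_ideal V n 2"
  shows "f_step f0 f = f \<longleftrightarrow>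
    (\<forall>i<n. \<forall>m. zbar_deg n m = 0 \<longrightarrow> mps_coeff (f $ i) m = mps_coeff (f0 $ i) m) \<and>
    (\<forall>i<n. \<forall>m. z_deg n m \<noteq> 0 \<longrightarrow>
      mps_coeff ((K Lzb f (map_vec series_cnj f) *\<^sub>v (Z + f)) $ i) m = 0)"
proof -
  let ?fb = "map_vec series_cnj f"
  let ?R = "remainder Lzb f ?fb" and ?K = "K Lzb f ?fb *\<^sub>v (Z + f)"
  have fc: "f \<in> carrier_vec n" and fbc: "?fb \<in> carrier_vec n"
    using f by (auto intro: vec_ideal_carrier)
  have K: "mps_coeff (?K $ i) m =
      mps_coeff (?R $ i) m + of_nat (z_deg n m) * cnj (mps_coeff (f $ i) (conj_mono m))"
    if i: "i < n" for i m
    unfolding remainder_def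
    using mps_coeff_euler_jac[OF fbc i, of n m] euler_eval_carrier[OF jac_carrier[OF fbc, of ZVar n]] i fc
    by simp
  have solve: "(\<forall>m. zbar_deg n m \<noteq> 0 \<longrightarrow>
        of_nat (zbar_deg n m) * mps_coeff (f $ i) m = mps_coeff (- series_cnj (?R $ i)) m) \<longleftrightarrow>
      (\<forall>m. z_deg n m \<noteq> 0 \<longrightarrow> mps_coeff (?K $ i) m = 0)" if i: "i < n" for i
  proof -
    have "of_nat (zbar_deg n m) * mps_coeff (f $ i) m = mps_coeff (- series_cnj (?R $ i)) m \<longleftrightarrow>
        mps_coeff (?K $ i) (conj_mono m) = 0" for m
    proof -
      have "cnj (mps_coeff (?K $ i) (conj_mono m)) =
          cnj (mps_coeff (?R $ i) (conj_mono m)) + of_nat (zbar_deg n m) * mps_coeff (f $ i) m"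
        by (simp add: K[OF i])
      moreover have "mps_coeff (?K $ i) (conj_mono m) = 0 \<longleftrightarrow>
          cnj (mps_coeff (?K $ i) (conj_mono m)) = 0" by simp
      ultimately show ?thesis
        by (metis add.commute eq_neg_iff_add_eq_0 mps_coeff_series_cnj mps_coeff_uminus)
    qed
    then have "?thesis \<longleftrightarrow> ((\<forall>m. zbar_deg n m \<noteq> 0 \<longrightarrow> mps_coeff (?K $ i) (conj_mono m) = 0) \<longleftrightarrow>
        (\<forall>m. z_deg n m \<noteq> 0 \<longrightarrow> mps_coeff (?K $ i) m = 0))"
      by simp
    \<comment> \<open>The involution \<open>conj_mono\<close> exchanges the two degrees, so it is
      absorbed by the quantification over all monomials.\<close>
    also have "\<dots>" by (metis conj_mono_conj_mono zbar_deg_conj_mono z_deg_conj_mono)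
    finally show ?thesis by simp
  qed
  have "f_step f0 f = f \<longleftrightarrow> (\<forall>i<n. euler_solve (zbar_deg n) (f0 $ i) (- series_cnj (?R $ i)) = f $ i)"
    using fc unfolding f_step_def by (auto simp: vec_eq_iff)
  then show ?thesis unfolding euler_solve_eq_iff using solve by blast
qed

text \<open>For real \<open>g\<close>, the real part of the Euler operator in \<open>z\<close>
  multiplies coefficients by half of \<open>z_deg + zbar_deg\<close>. Doubling the real part of the
  remainder clears this factor and leaves an integral weight.\<close>

definition g_step :: "series vec \<Rightarrow> series vec \<Rightarrow> series vec \<Rightarrow> series vec" where
  "g_step f g0 g = vec d (\<lambda>i. euler_solve (\<lambda>m. z_deg n m + zbar_deg n m) (g0 $ i)
     (- (series_Re (remainder Lw f g $ i) + series_Re (remainder Lw f g $ i))))"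

lemma g_step_unique_fixpoint:
  assumes f: "f \<in> vec_ideal V n 2" and g0: "g0 \<in> vec_ideal V d 2"
  shows "\<exists>!g. g \<in> vec_ideal V d 2 \<and> g_step f g0 g = g"
proof (rule vec_contraction_unique_fixpoint)
  fix g :: "series vec"
  assume g: "g \<in> vec_ideal V d 2"
  show "g_step f g0 g \<in> vec_ideal V d 2"
  proof -
    have r: "series_Re (remainder Lw f g $ i) \<in> mps_ideal V 2" if "i < d" for i
      by (rule series_Re_ideal[OF vec_idealD[OF remainder_ideal[OF f g Lw] that]])
    have "g_step f g0 g $ i \<in> mps_ideal V 2" if i: "i < d" for i
      using euler_solve_ideal[OF vec_idealD[OF g0 i] mps_ideal_uminus[OF mps_ideal_add[OF r[OF i] r[OF i]]]] i
      by (simp add: g_step_def)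
    then show ?thesis unfolding vec_ideal_def by (auto simp: g_step_def)
  qed
next
  fix g g' :: "series vec" and j
  assume g: "g \<in> vec_ideal V d 2" and g': "g' \<in> vec_ideal V d 2" and gg: "g - g' \<in> vec_ideal V d j"
  \<comment> \<open>With \<open>f\<close> held fixed its difference has every order, so
    \<open>remainder_contr\<close> measures the dependence on \<open>g\<close> alone.\<close>
  have "f - f = 0\<^sub>v n" using vec_ideal_carrier[OF f] by simp
  then have ff: "f - f \<in> vec_ideal V n j" by (simp add: zero_vec_ideal)
  note R = remainder_contr[OF f f g g' Lw ff gg]
  let ?R = "\<lambda>i. series_Re (remainder Lw f g $ i)" and ?R' = "\<lambda>i. series_Re (remainder Lw f g' $ i)"
  have R': "remainder Lw f g' \<in> carrier_vec d"
    using remainder_ideal[OF f g' Lw] by (rule vec_ideal_carrier)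
  have diff: "- (?R i + ?R i) - - (?R' i + ?R' i) \<in> mps_ideal V (Suc j)" if i: "i < d" for i
  proof -
    have "?R i - ?R' i = series_Re ((remainder Lw f g - remainder Lw f g') $ i)"
      using i R' by (simp add: series_Re_diff)
    then have "?R i - ?R' i \<in> mps_ideal V (Suc j)"
      using series_Re_ideal[OF vec_idealD[OF R i]] by simp
    from mps_ideal_uminus[OF mps_ideal_add[OF this this]] show ?thesis
      by (simp add: algebra_simps)
  qed
  have "(g_step f g0 g - g_step f g0 g') $ i \<in> mps_ideal V (Suc j)" if i: "i < d" for i
    using euler_solve_diff_ideal[OF diff[OF i]] i by (simp add: g_step_def)
  then show "g_step f g0 g - g_step f g0 g' \<in> vec_ideal V d (Suc j)"
    unfolding vec_ideal_def by (auto simp: g_step_def)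
qed

text \<open>The right-hand side is a real part, and the weight is invariant under conjugation. A
  fixed point is therefore real automatically, and the contraction can be run on all complex
  vectors.\<close>

lemma real_valued_g_step:
  assumes "\<forall>j<d. real_valued (g0 $ j)" "j < d"
  shows "real_valued (g_step f g0 g $ j)"
proof -
  have "real_valued (- (series_Re F + series_Re F))" for F
    using real_valued_series_Re[of F] unfolding real_valued_def
    by (intro mps_eqI) (metis complex_cnj_add complex_cnj_minus mps_coeff_add mps_coeff_series_cnj mps_coeff_uminus)
  then show ?thesis
    using assms by (auto simp: g_step_def add.commute intro!: real_valued_euler_solve simp del: minus_add_distrib)
qed

lemma g_step_fixpoint_iff:
  assumes f: "f \<in> vec_ideal V n 2" and g: "g \<in> vec_ideal V d 2" and real: "\<forall>j<d. real_valued (g $ j)"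
  shows "g_step f g0 g = g \<longleftrightarrow>
    (\<forall>i<d. \<forall>m. z_deg n m + zbar_deg n m = 0 \<longrightarrow> mps_coeff (g $ i) m = mps_coeff (g0 $ i) m) \<and>
    (\<forall>i<d. \<forall>m. z_deg n m + zbar_deg n m \<noteq> 0 \<longrightarrow>
      mps_coeff (series_Re ((K Lw f g *\<^sub>v (Z + f)) $ i)) m = 0)"
proof -
  let ?R = "remainder Lw f g" and ?K = "K Lw f g *\<^sub>v (Z + f)"
  let ?w = "\<lambda>m. z_deg n m + zbar_deg n m"
  have fc: "f \<in> carrier_vec n" and gc: "g \<in> carrier_vec d"
    using f g by (auto intro: vec_ideal_carrier)
  have K: "mps_coeff (?K $ i) m = mps_coeff (?R $ i) m + of_nat (z_deg n m) * mps_coeff (g $ i) m"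
    if i: "i < d" for i m
    unfolding remainder_def
    using mps_coeff_euler_jac[OF gc i, of n m] euler_eval_carrier[OF jac_carrier[OF gc, of ZVar n]] i fc
    by simp
  have solve: "of_nat (?w m) * mps_coeff (g $ i) m =
        mps_coeff (- (series_Re (?R $ i) + series_Re (?R $ i))) m \<longleftrightarrow>
      mps_coeff (series_Re (?K $ i)) m = 0" if i: "i < d" for i m
  proof -
    \<comment> \<open>By reality of \<open>g\<close> the terms at \<open>m\<close> and at its
      conjugate share one coefficient, so their weights \<open>z_deg\<close> and
      \<open>zbar_deg\<close> add.\<close>
    have "cnj (mps_coeff (g $ i) (conj_mono m)) = mps_coeff (g $ i) m"
      using real i unfolding real_valued_def by (metis mps_coeff_series_cnj)
    then have "mps_coeff (series_Re (?K $ i)) m = mps_coeff (series_Re (?R $ i)) m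
        + of_nat (?w m) * mps_coeff (g $ i) m / 2"
      by (simp add: mps_coeff_series_Re K[OF i] field_simps)
    then show ?thesis
      unfolding mps_coeff_add mps_coeff_uminus by (auto simp: field_simps eq_neg_iff_add_eq_0)
  qed
  have "g_step f g0 g = g \<longleftrightarrow> (\<forall>i<d. euler_solve ?w (g0 $ i)
      (- (series_Re (?R $ i) + series_Re (?R $ i))) = g $ i)"
    using gc unfolding g_step_def by (auto simp: vec_eq_iff)
  also have "\<dots> \<longleftrightarrow> (\<forall>i<d. (\<forall>m. ?w m = 0 \<longrightarrow> mps_coeff (g $ i) m = mps_coeff (g0 $ i) m) \<and>
      (\<forall>m. ?w m \<noteq> 0 \<longrightarrow> mps_coeff (series_Re (?K $ i)) m = 0))"
  proof (intro all_cong1 imp_cong refl)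
    fix i
    assume i: "i < d"
    show "euler_solve ?w (g0 $ i) (- (series_Re (?R $ i) + series_Re (?R $ i))) = g $ i \<longleftrightarrow>
        (\<forall>m. ?w m = 0 \<longrightarrow> mps_coeff (g $ i) m = mps_coeff (g0 $ i) m) \<and>
        (\<forall>m. ?w m \<noteq> 0 \<longrightarrow> mps_coeff (series_Re (?K $ i)) m = 0)"
      unfolding euler_solve_eq_iff solve[OF i] ..
  qed
  finally show ?thesis by (simp only: all_conj_distrib imp_conjR)
qed

end

section \<open>Initial conditions as conditions on coefficients\<close>

lemma higher_order_vec_eq: "higher_order_vec k V = vec_ideal V k 2"
  unfolding higher_order_vec_def vec_ideal_def mps_ideal_2_iff ..

text \<open>The coefficients of \<open>F0\<close> outside \<open>W\<close> vanish already, so only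
  monomials within \<open>W\<close> give a condition. The degree criterion \<open>P\<close> has to
  detect these only among monomials in \<open>V\<close>.\<close>

lemma subst_restrict_eq_iff:
  assumes F: "F \<in> mps_over V" and F0: "F0 \<in> mps_over W'" and sub: "W' \<subseteq> W"  "W' \<subseteq> V"
    and P: "\<And>m. Poly_Mapping.keys m \<subseteq> V \<Longrightarrow> P m \<longleftrightarrow> Poly_Mapping.keys m \<subseteq> W"
  shows "mps_subst (\<lambda>v. if v \<in> W then mps_X v else 0) F = F0 \<longleftrightarrow>
    (\<forall>m. P m \<longrightarrow> mps_coeff F m = mps_coeff F0 m)"
proof -
  have "(if Poly_Mapping.keys m \<subseteq> W then mps_coeff F m else 0) = mps_coeff F0 m \<longleftrightarrow>
      (P m \<longrightarrow> mps_coeff F m = mps_coeff F0 m)" for m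
  proof (cases "Poly_Mapping.keys m \<subseteq> V")
    case True
    have "mps_coeff F0 m = 0" if "\<not> Poly_Mapping.keys m \<subseteq> W"
      using that F0 sub(1) unfolding mps_over_def by blast
    then show ?thesis using P[OF True] by auto
  next
    case False
    then have "mps_coeff F m = 0" "mps_coeff F0 m = 0"
      using F F0 sub(2) unfolding mps_over_def by blast+
    then show ?thesis by simp
  qed
  moreover have "mps_subst (\<lambda>v. if v \<in> W then mps_X v else 0) F = F0 \<longleftrightarrow>
      (\<forall>m. (if Poly_Mapping.keys m \<subseteq> W then mps_coeff F m else 0) = mps_coeff F0 m)"
    unfolding mps_coeff_subst_restrict[symmetric] by (auto intro: mps_eqI)
  ultimately show ?thesis by simp
qed

lemma at_zbar_0_iff:
  assumes f: "f \<in> vec_ideal (coords n d) n 2"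
    and f0: "f0 \<in> vec_ideal (ZVar ` {..<n} \<union> UVar ` {..<d}) n 2"
  shows "at_zbar_0 f = f0 \<longleftrightarrow>
    (\<forall>i<n. \<forall>m. zbar_deg n m = 0 \<longrightarrow> mps_coeff (f $ i) m = mps_coeff (f0 $ i) m)"
proof -
  \<comment> \<open>All indices are included, as \<open>at_zbar_0\<close> keeps \<open>z\<close> and
    \<open>u\<close> variables of every index; within \<open>coords n d\<close> this matches
    vanishing of \<open>zbar_deg\<close>.\<close>
  define W where "W = range ZVar \<union> range UVar"
  have W: "(\<lambda>v. case v of ZVar j \<Rightarrow> mps_X (ZVar j) | ZbarVar j \<Rightarrow> 0 | UVar j \<Rightarrow> mps_X (UVar j))
      = (\<lambda>v. if v \<in> W then mps_X v else (0 :: series))"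
    by (auto simp: W_def split: coord.split)
  have deg: "zbar_deg n m = 0 \<longleftrightarrow> Poly_Mapping.keys m \<subseteq> W" if "Poly_Mapping.keys m \<subseteq> coords n d" for m
  proof -
    have "zbar_deg n m = 0 \<longleftrightarrow> (\<forall>j<n. ZbarVar j \<notin> Poly_Mapping.keys m)"
      by (auto simp: zbar_deg_def in_keys_iff)
    also have "\<dots> \<longleftrightarrow> Poly_Mapping.keys m \<subseteq> W"
      using that unfolding coords_def W_def by blast
    finally show ?thesis .
  qed
  have "at_zbar_0 f = f0 \<longleftrightarrow> (\<forall>i<n. mps_subst (\<lambda>v. if v \<in> W then mps_X v else 0) (f $ i) = f0 $ i)"
    unfolding at_zbar_0_def W using vec_ideal_carrier[OF f] vec_ideal_carrier[OF f0]
    by (auto simp: vec_eq_iff)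
  also have "\<dots> \<longleftrightarrow> (\<forall>i<n. \<forall>m. zbar_deg n m = 0 \<longrightarrow> mps_coeff (f $ i) m = mps_coeff (f0 $ i) m)"
  proof (intro all_cong1 imp_cong refl)
    fix i
    assume i: "i < n"
    show "mps_subst (\<lambda>v. if v \<in> W then mps_X v else 0) (f $ i) = f0 $ i \<longleftrightarrow>
        (\<forall>m. zbar_deg n m = 0 \<longrightarrow> mps_coeff (f $ i) m = mps_coeff (f0 $ i) m)"
      by (rule subst_restrict_eq_iff[OF mps_over_ideal[OF vec_idealD[OF f i]]
            mps_over_ideal[OF vec_idealD[OF f0 i]] _ _ deg])
        (auto simp: W_def coords_def)
  qed
  finally show ?thesis .
qed

lemma at_z_zbar_0_iff:
  assumes g: "g \<in> vec_ideal (coords n d) d 2" and g0: "g0 \<in> vec_ideal (UVar ` {..<d}) d 2"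
  shows "at_z_zbar_0 g = g0 \<longleftrightarrow>
    (\<forall>i<d. \<forall>m. z_deg n m + zbar_deg n m = 0 \<longrightarrow> mps_coeff (g $ i) m = mps_coeff (g0 $ i) m)"
proof -
  define W where "W = range UVar"
  have W: "(\<lambda>v. case v of ZVar j \<Rightarrow> 0 | ZbarVar j \<Rightarrow> 0 | UVar j \<Rightarrow> mps_X (UVar j))
      = (\<lambda>v. if v \<in> W then mps_X v else (0 :: series))"
    by (auto simp: W_def split: coord.split)
  have deg: "z_deg n m + zbar_deg n m = 0 \<longleftrightarrow> Poly_Mapping.keys m \<subseteq> W"
    if "Poly_Mapping.keys m \<subseteq> coords n d" for m
  proof -
    have "z_deg n m + zbar_deg n m = 0 \<longleftrightarrow>
        (\<forall>j<n. ZVar j \<notin> Poly_Mapping.keys m \<and> ZbarVar j \<notin> Poly_Mapping.keys m)"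
      by (auto simp: z_deg_def zbar_deg_def in_keys_iff)
    also have "\<dots> \<longleftrightarrow> Poly_Mapping.keys m \<subseteq> W"
      using that unfolding coords_def W_def by blast
    finally show ?thesis .
  qed
  have "at_z_zbar_0 g = g0 \<longleftrightarrow> (\<forall>i<d. mps_subst (\<lambda>v. if v \<in> W then mps_X v else 0) (g $ i) = g0 $ i)"
    unfolding at_z_zbar_0_def W using vec_ideal_carrier[OF g] vec_ideal_carrier[OF g0]
    by (auto simp: vec_eq_iff)
  also have "\<dots> \<longleftrightarrow> (\<forall>i<d. \<forall>m. z_deg n m + zbar_deg n m = 0 \<longrightarrow> mps_coeff (g $ i) m = mps_coeff (g0 $ i) m)"
  proof (intro all_cong1 imp_cong refl)
    fix i
    assume i: "i < d"
    show "mps_subst (\<lambda>v. if v \<in> W then mps_X v else 0) (g $ i) = g0 $ i \<longleftrightarrow>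
        (\<forall>m. z_deg n m + zbar_deg n m = 0 \<longrightarrow> mps_coeff (g $ i) m = mps_coeff (g0 $ i) m)"
      by (rule subst_restrict_eq_iff[OF mps_over_ideal[OF vec_idealD[OF g i]]
            mps_over_ideal[OF vec_idealD[OF g0 i]] _ _ deg])
        (auto simp: W_def coords_def)
  qed
  finally show ?thesis .
qed

lemma vec_ideal_mono_vars: "x \<in> vec_ideal W r k \<Longrightarrow> W \<subseteq> V \<Longrightarrow> x \<in> vec_ideal V r k"
  unfolding vec_ideal_def mps_ideal_iff by (simp, meson subset_trans)

lemma ex1_eqD: "\<exists>!x. P x \<Longrightarrow> P a \<Longrightarrow> P b \<Longrightarrow> a = b"
  by blast

theorem proposition5p2:
  fixes n d :: nat
    and Lzb Lw :: "series mat"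
    and f0 g0 :: "series vec"
  assumes "formal_almost_CR n d Lzb Lw"
    and "f0 \<in> higher_order_vec n (ZVar ` {..<n} \<union> UVar ` {..<d})"
    and "g0 \<in> higher_order_vec d (UVar ` {..<d})"
    and "\<forall>j<d. real_valued (g0 $ j)"
  shows "\<exists>!p. case p of (f, g) \<Rightarrow>
    f \<in> higher_order_vec n (coords n d) \<and>
    g \<in> higher_order_vec d (coords n d) \<and> (\<forall>j<d. real_valued (g $ j)) \<and>
    at_zbar_0 f = f0 \<and> at_z_zbar_0 g = g0 \<and>
    (\<exists>Lzb' Lw'. formal_almost_CR n d Lzb' Lw' \<and>
       transforms n d f g Lzb Lw Lzb' Lw' \<and>
       euler_eval n Lzb' = 0\<^sub>v n \<and>
       map_vec series_Re (euler_eval n Lw') = 0\<^sub>v d)"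
proof -
  let ?N = "\<lambda>f g. f \<in> higher_order_vec n (coords n d) \<and>
    g \<in> higher_order_vec d (coords n d) \<and> (\<forall>j<d. real_valued (g $ j)) \<and>
    at_zbar_0 f = f0 \<and> at_z_zbar_0 g = g0 \<and>
    (\<exists>Lzb' Lw'. formal_almost_CR n d Lzb' Lw' \<and>
       transforms n d f g Lzb Lw Lzb' Lw' \<and>
       euler_eval n Lzb' = 0\<^sub>v n \<and>
       map_vec series_Re (euler_eval n Lw') = 0\<^sub>v d)"
  interpret almost_CR n d Lzb Lw
    using assms(1) unfolding formal_almost_CR_iff by unfold_locales auto
  have f0: "f0 \<in> vec_ideal (ZVar ` {..<n} \<union> UVar ` {..<d}) n 2"
    and g0: "g0 \<in> vec_ideal (UVar ` {..<d}) d 2"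
    using assms(2,3) by (simp_all add: higher_order_vec_eq)
  have f0': "f0 \<in> vec_ideal V n 2" and g0': "g0 \<in> vec_ideal V d 2"
    by (rule vec_ideal_mono_vars[OF f0] vec_ideal_mono_vars[OF g0]; auto simp: coords_def)+
  \<comment> \<open>The system is triangular: the condition on \<open>f\<close> does not mention
    \<open>g\<close>, and \<open>g\<close> solves a fixed point equation with parameter
    \<open>f\<close>.\<close>
  have N: "?N f g \<longleftrightarrow> (f \<in> vec_ideal V n 2 \<and> f_step f0 f = f) \<and> (g \<in> vec_ideal V d 2 \<and> g_step f g0 g = g)"
    (is "_ \<longleftrightarrow> ?F \<and> ?G") for f g
  proof -
    \<comment> \<open>Rewriting the normalization requires a real \<open>g\<close>. The left-hand
      side contains this, and on the right-hand side it follows from the fixed point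
      equation.\<close>
    have real: "\<forall>j<d. real_valued (g $ j)" if "g_step f g0 g = g"
      using real_valued_g_step[OF assms(4), of _ f g] that by simp
    have eq: "?N f g \<longleftrightarrow> ?F \<and> ?G" if fg: "f \<in> vec_ideal V n 2" "g \<in> vec_ideal V d 2"
      and g: "\<forall>j<d. real_valued (g $ j)"
      unfolding higher_order_vec_eq normalization_iff[OF fg g] at_zbar_0_iff[OF fg(1) f0]
        at_z_zbar_0_iff[OF fg(2) g0] f_step_fixpoint_iff[OF fg(1)] g_step_fixpoint_iff[OF fg g]
      using fg g by - (rule iffI; elim conjE; intro conjI; assumption)
    show ?thesis
    proof
      assume N: "?N f g"
      then have "f \<in> vec_ideal V n 2" "g \<in> vec_ideal V d 2" "\<forall>j<d. real_valued (g $ j)"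
        unfolding higher_order_vec_eq by - (elim conjE, assumption)+
      from eq[OF this] N show "?F \<and> ?G" by (rule iffD1)
    next
      assume FG: "?F \<and> ?G"
      then have "f \<in> vec_ideal V n 2" "g \<in> vec_ideal V d 2" "g_step f g0 g = g"
        by - (elim conjE, assumption)+
      from eq[OF this(1,2) real[OF this(3)]] FG show "?N f g" by (rule iffD2)
    qed
  qed
  have "\<exists>!p. case p of (f, g) \<Rightarrow> ?N f g"
  proof -
    \<comment> \<open>The fixed point \<open>f\<close> is found first and then \<open>g\<close> for
      this \<open>f\<close>; uniqueness follows in the same order.\<close>
    obtain f where f: "f \<in> vec_ideal V n 2 \<and> f_step f0 f = f"
      using ex1_implies_ex[OF f_step_unique_fixpoint[OF f0']] by (rule exE)
    then have f': "f \<in> vec_ideal V n 2" by (rule conjunct1)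
    obtain g where g: "g \<in> vec_ideal V d 2 \<and> g_step f g0 g = g"
      using ex1_implies_ex[OF g_step_unique_fixpoint[OF f' g0']] by (rule exE)
    show ?thesis
      unfolding N
    proof (rule ex1I)
      show "case (f, g) of (f, g) \<Rightarrow>
          (f \<in> vec_ideal V n 2 \<and> f_step f0 f = f) \<and> (g \<in> vec_ideal V d 2 \<and> g_step f g0 g = g)"
        unfolding prod.case using f g by (rule conjI)
      fix p
      assume p: "case p of (f, g) \<Rightarrow>
          (f \<in> vec_ideal V n 2 \<and> f_step f0 f = f) \<and> (g \<in> vec_ideal V d 2 \<and> g_step f g0 g = g)"
      obtain f2 g2 where p_eq: "p = (f2, g2)" by (cases p)
      have f2: "f2 \<in> vec_ideal V n 2 \<and> f_step f0 f2 = f2"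
        and g2: "g2 \<in> vec_ideal V d 2 \<and> g_step f2 g0 g2 = g2"
        using p unfolding p_eq prod.case by (rule conjunct1, rule conjunct2)
      have ff: "f2 = f" using f_step_unique_fixpoint[OF f0'] f2 f by (rule ex1_eqD)
      have "g2 = g" using g_step_unique_fixpoint[OF f' g0'] g2[unfolded ff] g by (rule ex1_eqD)
      with ff show "p = (f, g)" by (simp only: p_eq)
    qed
  qed
  then show ?thesis .
qed

end
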